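(* Let $\Omega\subset\mathbb{C}^n$ be a smooth bounded strongly pseudoconvex domain, let $g\ge0$ be a bounded continuous function in $\Omega$ and $\nu=g\,dV$. If $\{z\in\Omega: g(z)=0\}$ is a negligible set, then $(\phi,\nu)$ is admissible for every $\phi\in C(\overline{\Omega})\cap PSH(\Omega)$.
   Context: $dV$ is the standard volume form on $\mathbb{C}^n$ and $PSH(\Omega)$ is the set of plurisubharmonic functions on $\Omega$. Negligible set (in the sense of pluripotential theory): a set contained in $\{\sup_\alpha u_\alpha<(\sup_\alpha u_\alpha)^*\}$ for some family $(u_\alpha)$ of plurisubharmonic functions locally uniformly bounded above, where $^*$ denotes upper semicontinuous regularization; equivalently (Bedford-Taylor), a pluripolar set. Admissibility: $(\phi,\nu)$ is admissible if for every $\epsilon>0$ there exist $u_\epsilon\in C(\overline{\Omega})$ and $C_\epsilon>0$ such that $\phi\le u_\epsilon\le\phi+\epsilon$ and $(dd^cu_\epsilon)^n\le e^{C_\epsilon}\nu$ in $\Omega$ in the viscosity sense, i.e. for every $z_0\in\Omega$ and every $C^2$ function $q$ near $z_0$ with $q(z_0)=u_\epsilon(z_0)$, $q\le u_\epsilon$ near $z_0$ and $dd^cq(z_0)\ge0$, one has $(dd^cq)^n(z_0)\le e^{C_\epsilon}g(z_0)\,dV$. *)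

theory Defs
  imports "HOL-Analysis.Analysis"
begin

text \<open>The space \<open>\<complex>\<^sup>n\<close> is \<^typ>\<open>complex ^ 'n\<close>, with \<open>n = CARD('n)\<close>; differentiability is always
  real differentiability.\<close>

section \<open>Real smoothness and Wirtinger calculus\<close>

text \<open>\<open>C\<^sup>k\<close> regularity on an open set, by iterated directional derivatives.\<close>

primrec Ck_on :: "nat \<Rightarrow> ('a::real_normed_vector \<Rightarrow> 'b::real_normed_vector) \<Rightarrow> 'a set \<Rightarrow> bool" where
  "Ck_on 0 f U \<longleftrightarrow> continuous_on U f"
| "Ck_on (Suc k) f U \<longleftrightarrow> (\<forall>x\<in>U. f differentiable (at x)) \<and>
     (\<forall>v. Ck_on k (\<lambda>x. frechet_derivative f (at x) v) U)"

text \<open>\<open>\<partial>f/\<partial>z\<^sub>j = (\<partial>f/\<partial>x\<^sub>j - i \<partial>f/\<partial>y\<^sub>j) / 2\<close> and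
  \<open>\<partial>f/\<partial>\<bar>z\<^sub>j = (\<partial>f/\<partial>x\<^sub>j + i \<partial>f/\<partial>y\<^sub>j) / 2\<close>, where \<open>z\<^sub>j = x\<^sub>j + i y\<^sub>j\<close>.\<close>

definition dz :: "'n::finite \<Rightarrow> (complex ^ 'n \<Rightarrow> complex) \<Rightarrow> complex ^ 'n \<Rightarrow> complex" where
  "dz j f z = (frechet_derivative f (at z) (axis j 1)
                 - \<i> * frechet_derivative f (at z) (axis j \<i>)) / 2"

definition dzbar :: "'n::finite \<Rightarrow> (complex ^ 'n \<Rightarrow> complex) \<Rightarrow> complex ^ 'n \<Rightarrow> complex" where
  "dzbar j f z = (frechet_derivative f (at z) (axis j 1)
                    + \<i> * frechet_derivative f (at z) (axis j \<i>)) / 2"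

definition complex_hessian :: "(complex ^ 'n::finite \<Rightarrow> real) \<Rightarrow> complex ^ 'n \<Rightarrow> complex ^ 'n ^ 'n" where
  "complex_hessian q z = (\<chi> j k. dz j (dzbar k (\<lambda>w. complex_of_real (q w))) z)"

text \<open>For \<open>q\<close> of class \<open>C\<^sup>2\<close> the sum below is real, since the complex Hessian is Hermitian.\<close>

definition levi_form :: "(complex ^ 'n::finite \<Rightarrow> real) \<Rightarrow> complex ^ 'n \<Rightarrow> complex ^ 'n \<Rightarrow> real" where
  "levi_form q z w = Re (\<Sum>j\<in>UNIV. \<Sum>k\<in>UNIV. complex_hessian q z $ j $ k * (w $ j) * cnj (w $ k))"

definition ddc_nonneg :: "(complex ^ 'n::finite \<Rightarrow> real) \<Rightarrow> complex ^ 'n \<Rightarrow> bool" where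
  "ddc_nonneg q z \<longleftrightarrow> (\<forall>w. levi_form q z w \<ge> 0)"

text \<open>The density of \<open>(dd\<^sup>c q)\<^sup>n\<close> with respect to the standard volume form \<open>dV\<close>, for the
  normalisation \<open>dd\<^sup>c = i \<partial>\<partial>\<bar>\<close>: expanding the wedge product gives
  \<open>(dd\<^sup>c q)\<^sup>n = n! det(q\<^sub>j\<^sub>k) \<Prod>\<^sub>j (i dz\<^sub>j \<and> d\<bar>z\<^sub>j)\<close>, and \<open>i dz\<^sub>j \<and> d\<bar>z\<^sub>j = 2 dx\<^sub>j \<and> dy\<^sub>j\<close>.
  The determinant is real for \<open>q\<close> of class \<open>C\<^sup>2\<close>.  Another normalisation of \<open>d\<^sup>c\<close> multiplies the
  density by a positive constant, which the factor \<open>e\<^sup>C\<close> in admissibility absorbs.\<close>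

definition monge_ampere_density :: "(complex ^ 'n::finite \<Rightarrow> real) \<Rightarrow> complex ^ 'n \<Rightarrow> real" where
  "monge_ampere_density q z = 2 ^ CARD('n) * fact CARD('n) * Re (det (complex_hessian q z))"


section \<open>Strongly pseudoconvex domains\<close>

text \<open>The condition \<open>\<Sum>\<^sub>j \<partial>\<rho>/\<partial>z\<^sub>j w\<^sub>j = 0\<close> says that \<open>w\<close> is in the complex tangent space of
  the boundary.\<close>

definition smooth_bounded_strongly_pseudoconvex_domain :: "(complex ^ 'n::finite) set \<Rightarrow> bool" where
  "smooth_bounded_strongly_pseudoconvex_domain \<Omega> \<longleftrightarrow>
     open \<Omega> \<and> connected \<Omega> \<and> \<Omega> \<noteq> {} \<and> bounded \<Omega> \<and>
     (\<exists>\<rho> U. open U \<and> frontier \<Omega> \<subseteq> U \<and> (\<forall>k. Ck_on k \<rho> U) \<and> \<Omega> \<inter> U = {z\<in>U. \<rho> z < (0::real)} \<and>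
        (\<forall>p\<in>frontier \<Omega>. frechet_derivative \<rho> (at p) \<noteq> (\<lambda>_. 0) \<and>
           (\<forall>w. w \<noteq> 0 \<and> (\<Sum>j\<in>UNIV. dz j (\<lambda>z. complex_of_real (\<rho> z)) p * (w $ j)) = 0
              \<longrightarrow> levi_form \<rho> p w > 0)))"


section \<open>Plurisubharmonic functions and negligible sets\<close>

text \<open>The limit superior over the filter below takes the value at \<open>z\<close> itself into account, so
  for \<open>z \<in> D\<close> this is the least upper semicontinuous majorant of \<open>u\<close> on \<open>D\<close>.\<close>

definition usc_regularization :: "'a::topological_space set \<Rightarrow> ('a \<Rightarrow> ereal) \<Rightarrow> 'a \<Rightarrow> ereal" where
  "usc_regularization D u z = Limsup (inf (nhds z) (principal D)) u"

definition usc_on :: "'a::topological_space set \<Rightarrow> ('a \<Rightarrow> ereal) \<Rightarrow> bool" where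
  "usc_on D u \<longleftrightarrow> (\<forall>z\<in>D. usc_regularization D u z \<le> u z)"

text \<open>The integral over \<open>\<theta> \<in> [0, 2\<pi>]\<close> of \<open>u (a + e\<^sup>i\<^sup>\<theta> b)\<close> as the difference of the integrals of
  positive and negative part (\<^const>\<open>e2ennreal\<close> truncates negative values to 0).  For an upper
  semicontinuous \<open>u < \<infinity>\<close> the first integral is finite.\<close>

definition circle_integral ::
    "(complex ^ 'n::finite \<Rightarrow> ereal) \<Rightarrow> complex ^ 'n \<Rightarrow> complex ^ 'n \<Rightarrow> ereal" where
  "circle_integral u a b =
     enn2ereal (\<integral>\<^sup>+\<theta>\<in>{0..2 * pi}. e2ennreal (u (a + cis \<theta> *s b)) \<partial>lborel)
   - enn2ereal (\<integral>\<^sup>+\<theta>\<in>{0..2 * pi}. e2ennreal (- u (a + cis \<theta> *s b)) \<partial>lborel)"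

definition plurisubharmonic_on :: "(complex ^ 'n::finite) set \<Rightarrow> (complex ^ 'n \<Rightarrow> ereal) \<Rightarrow> bool" where
  "plurisubharmonic_on D u \<longleftrightarrow>
     (\<forall>z\<in>D. u z < \<infinity>) \<and> usc_on D u \<and>
     (\<forall>K\<in>components D. \<exists>z\<in>K. u z \<noteq> - \<infinity>) \<and>
     (\<forall>a b. (\<forall>\<zeta>. norm \<zeta> \<le> 1 \<longrightarrow> a + \<zeta> *s b \<in> D)
        \<longrightarrow> ereal (2 * pi) * u a \<le> circle_integral u a b)"

definition locally_uniformly_bounded_above_on ::
    "'a::topological_space set \<Rightarrow> ('a \<Rightarrow> ereal) set \<Rightarrow> bool" where
  "locally_uniformly_bounded_above_on D F \<longleftrightarrow>
     (\<forall>z\<in>D. \<exists>V M. open V \<and> z \<in> V \<and> (\<forall>u\<in>F. \<forall>w\<in>V \<inter> D. u w \<le> ereal M))"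

definition negligible_in :: "(complex ^ 'n::finite) set \<Rightarrow> (complex ^ 'n) set \<Rightarrow> bool" where
  "negligible_in D N \<longleftrightarrow>
     (\<exists>F. (\<forall>u\<in>F. plurisubharmonic_on D u) \<and> locally_uniformly_bounded_above_on D F \<and>
        N \<subseteq> {z\<in>D. (SUP u\<in>F. u z) < usc_regularization D (\<lambda>w. SUP u\<in>F. u w) z})"


section \<open>Viscosity supersolutions and admissibility\<close>

text \<open>A measure \<open>g dV\<close> with \<open>g\<close> continuous is represented by its density \<open>g\<close> in what follows.\<close>

text \<open>\<open>(dd\<^sup>c u)\<^sup>n \<le> h dV\<close> in \<open>\<Omega>\<close> in the viscosity sense.\<close>

definition viscosity_MA_le ::
    "(complex ^ 'n::finite) set \<Rightarrow> (complex ^ 'n \<Rightarrow> real) \<Rightarrow> (complex ^ 'n \<Rightarrow> real) \<Rightarrow> bool" where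
  "viscosity_MA_le \<Omega> u h \<longleftrightarrow>
     (\<forall>z0\<in>\<Omega>. \<forall>q U. open U \<and> z0 \<in> U \<and> Ck_on 2 q U \<and> q z0 = u z0 \<and>
        (\<forall>\<^sub>F z in nhds z0. q z \<le> u z) \<and> ddc_nonneg q z0
        \<longrightarrow> monge_ampere_density q z0 \<le> h z0)"

definition admissible ::
    "(complex ^ 'n::finite) set \<Rightarrow> (complex ^ 'n \<Rightarrow> real) \<Rightarrow> (complex ^ 'n \<Rightarrow> real) \<Rightarrow> bool" where
  "admissible \<Omega> \<phi> g \<longleftrightarrow>
     (\<forall>\<epsilon>>0. \<exists>u C. continuous_on (closure \<Omega>) u \<and> C > 0 \<and>
        (\<forall>z\<in>closure \<Omega>. \<phi> z \<le> u z \<and> u z \<le> \<phi> z + \<epsilon>) \<and>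
        viscosity_MA_le \<Omega> u (\<lambda>z. exp C * g z))"

end

theory Submission
  imports Defs
begin

text \<open>The zero set \<open>E\<close> of \<open>g\<close> together with \<open>\<partial>\<Omega>\<close> is compact and Lebesgue null, and this is all that
  is needed.  Approximate \<open>\<phi> + \<epsilon>/2\<close> on the closure of \<open>\<Omega>\<close> by a polynomial \<open>f\<close>, with Laplacian at most
  \<open>L\<close>, and add a uniformly small smooth superharmonic function \<open>s\<close> whose Laplacian is below \<open>- L\<close> near
  \<open>E\<close>; it is a sum of Newtonian kernels over a fine net of \<open>E\<close>, small because \<open>E\<close> is null.  If \<open>q\<close>
  touches \<open>f + s\<close> from below, then the trace of its complex Hessian is at most a multiple of the
  Laplacian of \<open>f + s\<close>.  Near \<open>E\<close> this is negative, so \<open>dd\<^sup>c q \<ge> 0\<close> is impossible; away from \<open>E\<close> the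
  density \<open>g\<close> is bounded below, and the trace of a nonnegative Hermitian matrix bounds its
  determinant.  Negligible sets are null because the sub-mean value property forces the density of
  \<open>{sup u < a < (sup u)\<^sup>*}\<close> to vanish at each of its points.\<close>

section \<open>Symmetric second differences\<close>

text \<open>No Monge-Ampere equation is solved. A test function below \<open>u\<close> inherits only
  upper bounds on second derivatives along real lines, so the proof controls \<open>u\<close>
  through its Laplacian, and the positivity of the complex Hessian of \<open>q\<close> turns the
  trace bound into a determinant bound. The obstacle is that g may tend to zero at the boundary as
  well as on its zero set, where no constant helps. Hence the frontier is put into E: the part of
  \<Omega> off a neighbourhood of E is then compact and g has a positive minimum on it. The
  correction \<open>s\<close> can have Laplacian below - L near E and still be small for the
  following reason. Mass spread with density L over volume v, integrated against the kernel
  |x|^(1-m) in real dimension m, is worst when it fills a ball around the pole, and this gives order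
  L v^(1/m). The net discretises this: each kernel has weight of order h^m, the packing bound limits
  the number N of points to order v / h^m, and the resulting bound of order h N^(1/m) depends on v
  but not on the scale h.\<close>

definition has_second_difference ::
    "('a::real_normed_vector \<Rightarrow> real) \<Rightarrow> 'a \<Rightarrow> 'a \<Rightarrow> real \<Rightarrow> bool" where
  "has_second_difference f b z e \<longleftrightarrow>
     ((\<lambda>t. (f (z + t *\<^sub>R b) + f (z - t *\<^sub>R b) - 2 * f z) / t\<^sup>2) \<longlongrightarrow> e) (at_right 0)"

lemma has_second_difference_add:
  assumes "has_second_difference f b z d" "has_second_difference g b z e"
  shows "has_second_difference (\<lambda>x. f x + g x) b z (d + e)"
proof -
  have "((f (z + t *\<^sub>R b) + g (z + t *\<^sub>R b)) + (f (z - t *\<^sub>R b) + g (z - t *\<^sub>R b)) - 2 * (f z + g z)) / t\<^sup>2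
      = (f (z + t *\<^sub>R b) + f (z - t *\<^sub>R b) - 2 * f z) / t\<^sup>2
        + (g (z + t *\<^sub>R b) + g (z - t *\<^sub>R b) - 2 * g z) / t\<^sup>2" for t
    by (simp flip: add_divide_distrib)
  with tendsto_add[OF assms[unfolded has_second_difference_def]] show ?thesis
    by (simp add: has_second_difference_def)
qed

lemma has_second_difference_cmult:
  assumes "has_second_difference f b z d"
  shows "has_second_difference (\<lambda>x. c * f x) b z (c * d)"
proof -
  have eq: "(c * f (z + t *\<^sub>R b) + c * f (z - t *\<^sub>R b) - 2 * (c * f z)) / t\<^sup>2
      = c * ((f (z + t *\<^sub>R b) + f (z - t *\<^sub>R b) - 2 * f z) / t\<^sup>2)" for t
    by (simp add: algebra_simps)
  show ?thesis
    unfolding has_second_difference_def eq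
    by (rule tendsto_mult_left[OF assms[unfolded has_second_difference_def]])
qed

lemma has_second_difference_sum:
  assumes "finite S" "\<And>i. i \<in> S \<Longrightarrow> has_second_difference (f i) b z (d i)"
  shows "has_second_difference (\<lambda>x. \<Sum>i\<in>S. f i x) b z (\<Sum>i\<in>S. d i)"
  using assms
proof (induction S rule: finite_induct)
  case empty
  then show ?case by (simp add: has_second_difference_def)
next
  case (insert x F)
  then show ?case
    by (simp add: has_second_difference_add)
qed

text \<open>The central values cancel because \<open>q z = u z\<close>, and the outer values are
  ordered near \<open>z\<close>. This is why second derivatives are encoded by symmetric second
  differences: the comparison needs no \<open>Ck_on\<close> class for \<open>u\<close>.\<close>

lemma has_second_difference_touching:
  assumes q: "has_second_difference q b z d" and u: "has_second_difference u b z e"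
    and le: "\<forall>\<^sub>F x in nhds z. q x \<le> u x" and eq: "q z = u z"
  shows "d \<le> e"
proof -
  have "((\<lambda>t. z + t *\<^sub>R b) \<longlongrightarrow> z) (at_right (0::real))"
    by (auto intro!: tendsto_eq_intros)
  then have 1: "\<forall>\<^sub>F t in at_right 0. q (z + t *\<^sub>R b) \<le> u (z + t *\<^sub>R b)"
    by (rule eventually_compose_filterlim[OF le])
  have "((\<lambda>t. z - t *\<^sub>R b) \<longlongrightarrow> z) (at_right (0::real))"
    by (auto intro!: tendsto_eq_intros)
  then have 2: "\<forall>\<^sub>F t in at_right 0. q (z - t *\<^sub>R b) \<le> u (z - t *\<^sub>R b)"
    by (rule eventually_compose_filterlim[OF le])
  have "\<forall>\<^sub>F t in at_right 0. (q (z + t *\<^sub>R b) + q (z - t *\<^sub>R b) - 2 * q z) / t\<^sup>2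
          \<le> (u (z + t *\<^sub>R b) + u (z - t *\<^sub>R b) - 2 * u z) / t\<^sup>2"
    using 1 2 by eventually_elim (auto intro!: divide_right_mono simp: eq)
  then show ?thesis
    using tendsto_le[OF _ u[unfolded has_second_difference_def] q[unfolded has_second_difference_def]]
    by simp
qed

text \<open>One use of L'Hopital's rule leads to
  \<open>(\<phi>' t - \<phi>' (- t)) / (2 * t)\<close>, the mean of the two difference quotients of
  \<open>\<phi>'\<close> at 0 with steps t and - t; both tend to e.\<close>

lemma has_second_differenceI:
  assumes D: "\<forall>\<^sub>F t in nhds 0. ((\<lambda>t. f (z + t *\<^sub>R b)) has_real_derivative \<phi>' t) (at t)"
    and D2: "(\<phi>' has_real_derivative e) (at 0)"
  shows "has_second_difference f b z e"
proof -
  define \<phi> where "\<phi> t = f (z + t *\<^sub>R b)" for t :: real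
  have D: "\<forall>\<^sub>F t in nhds 0. (\<phi> has_real_derivative \<phi>' t) (at t)"
    using D by (simp add: \<phi>_def [abs_def])
  then obtain r where r: "r > 0" "\<And>t. \<bar>t\<bar> < r \<Longrightarrow> (\<phi> has_real_derivative \<phi>' t) (at t)"
    by (auto simp: eventually_nhds_metric dist_real_def)
  have cont: "isCont \<phi> 0"
    using r(1) r(2)[of 0] DERIV_isCont by auto
  have lim0: "((\<lambda>t. \<phi> t + \<phi> (- t) - 2 * \<phi> 0) \<longlongrightarrow> 0) (at_right 0)"
  proof -
    have "isCont (\<lambda>t. \<phi> t + \<phi> (- t) - 2 * \<phi> 0) 0"
      using cont isCont_o2[of 0 uminus \<phi>] by (intro continuous_intros) auto
    then show ?thesis
      by (auto simp: isCont_def intro: filterlim_at_split[THEN iffD1, THEN conjunct2])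
  qed
  have ev: "\<forall>\<^sub>F t in at_right 0. t > 0 \<and> t < r"
    using r(1) by (auto simp: eventually_at_right_field)
  have lim: "((\<lambda>t. (\<phi>' t - \<phi>' (- t)) / (2 * t)) \<longlongrightarrow> e) (at_right 0)"
  proof -
    have 1: "((\<lambda>t. (\<phi>' t - \<phi>' 0) / t) \<longlongrightarrow> e) (at 0)"
      using D2 by (simp add: has_field_derivative_iff)
    have "((\<lambda>t. (\<phi>' (- t) - \<phi>' 0) / (- t)) \<longlongrightarrow> e) (at 0)"
    proof (rule filterlim_compose[OF 1])
      show "filterlim uminus (at 0) (at (0::real))"
        unfolding filterlim_at by (auto intro!: tendsto_eq_intros simp: eventually_at_filter)
    qed
    from tendsto_divide[OF tendsto_add[OF 1 this] tendsto_const[of 2] zero_neq_numeral[symmetric]]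
    have "((\<lambda>t. ((\<phi>' t - \<phi>' 0) / t + (\<phi>' (- t) - \<phi>' 0) / (- t)) / 2) \<longlongrightarrow> (e + e) / 2) (at 0)" .
    moreover have "((\<phi>' t - \<phi>' 0) / t + (\<phi>' (- t) - \<phi>' 0) / (- t)) / 2 = (\<phi>' t - \<phi>' (- t)) / (2 * t)" for t
      by (cases "t = 0") (simp_all add: add_divide_distrib diff_divide_distrib)
    ultimately have "((\<lambda>t. (\<phi>' t - \<phi>' (- t)) / (2 * t)) \<longlongrightarrow> (e + e) / 2) (at 0)"
      by (simp only:)
    then show ?thesis
      by (simp add: filterlim_at_split)
  qed
  have "((\<lambda>t. (\<phi> t + \<phi> (- t) - 2 * \<phi> 0) / t\<^sup>2) \<longlongrightarrow> e) (at_right 0)"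
  proof (rule lhopital_right_0[OF lim0 _ _ _ _ _ lim])
    show "((\<lambda>t::real. t\<^sup>2) \<longlongrightarrow> 0) (at_right 0)"
      by (auto intro!: tendsto_eq_intros)
    show "\<forall>\<^sub>F t in at_right (0::real). t\<^sup>2 \<noteq> 0" "\<forall>\<^sub>F t in at_right (0::real). 2 * t \<noteq> 0"
      using ev by (auto elim: eventually_mono)
    show "\<forall>\<^sub>F t in at_right (0::real). ((\<lambda>t. t\<^sup>2) has_real_derivative 2 * t) (at t)"
      by (auto intro!: derivative_eq_intros always_eventually)
    show "\<forall>\<^sub>F t in at_right 0. ((\<lambda>t. \<phi> t + \<phi> (- t) - 2 * \<phi> 0) has_real_derivative \<phi>' t - \<phi>' (- t)) (at t)"
      using ev
    proof eventually_elim
      case (elim t)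
      have "(\<phi> has_real_derivative \<phi>' (- t)) (at (- t))"
        using elim r by auto
      then have "((\<lambda>t. \<phi> (- t)) has_real_derivative - \<phi>' (- t)) (at t)"
        by (simp add: DERIV_mirror)
      then show ?case
        using elim r by (auto intro!: derivative_eq_intros)
    qed
  qed
  then show ?thesis
    by (simp add: has_second_difference_def \<phi>_def)
qed

section \<open>Second differences of polynomials\<close>

lemma real_polynomial_function_directional_derivative:
  assumes "real_polynomial_function f"
  shows "\<exists>g. real_polynomial_function g \<and>
           (\<forall>z t. ((\<lambda>t. f (z + t *\<^sub>R b)) has_real_derivative g (z + t *\<^sub>R b)) (at t))"
  using assms
proof induction
  case (linear f)
  have "((\<lambda>t. f (z + t *\<^sub>R b)) has_real_derivative f b) (at t)" for z t
    using linear by (auto intro!: derivative_eq_intros simp: linear_simps bounded_linear.linear)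
  then show ?case
    by (intro exI[of _ "\<lambda>_. f b"]) auto
next
  case (const c)
  show ?case by (intro exI[of _ "\<lambda>_. 0"]) auto
next
  case (add f g)
  then obtain f' g' where "real_polynomial_function f'" "real_polynomial_function g'"
    "\<And>z t. ((\<lambda>t. f (z + t *\<^sub>R b)) has_real_derivative f' (z + t *\<^sub>R b)) (at t)"
    "\<And>z t. ((\<lambda>t. g (z + t *\<^sub>R b)) has_real_derivative g' (z + t *\<^sub>R b)) (at t)"
    by blast
  then show ?case
    by (intro exI[of _ "\<lambda>x. f' x + g' x"]) (auto intro!: derivative_eq_intros)
next
  case (mult f g)
  then obtain f' g' where *: "real_polynomial_function f'" "real_polynomial_function g'"
    "\<And>z t. ((\<lambda>t. f (z + t *\<^sub>R b)) has_real_derivative f' (z + t *\<^sub>R b)) (at t)"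
    "\<And>z t. ((\<lambda>t. g (z + t *\<^sub>R b)) has_real_derivative g' (z + t *\<^sub>R b)) (at t)"
    by blast
  then show ?case
    using mult.hyps
    by (intro exI[of _ "\<lambda>x. f' x * g x + f x * g' x"]) (auto intro!: derivative_eq_intros)
qed

text \<open>That the result is again a polynomial later makes the Laplacian of the approximant
  continuous, hence bounded on the compact closure of \<Omega>.\<close>

lemma real_polynomial_function_second_difference:
  assumes "real_polynomial_function f"
  obtains g where "real_polynomial_function g" "\<And>z. has_second_difference f b z (g z)"
proof -
  obtain f' where f': "real_polynomial_function f'"
    "\<And>z t. ((\<lambda>t. f (z + t *\<^sub>R b)) has_real_derivative f' (z + t *\<^sub>R b)) (at t)"
    using real_polynomial_function_directional_derivative[OF assms] by blast
  obtain g where g: "real_polynomial_function g"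
    "\<And>z t. ((\<lambda>t. f' (z + t *\<^sub>R b)) has_real_derivative g (z + t *\<^sub>R b)) (at t)"
    using real_polynomial_function_directional_derivative[OF f'(1)] by blast
  have "has_second_difference f b z (g z)" for z
    using f'(2)[of z] g(2)[of z 0]
    by (intro has_second_differenceI[of f z b "\<lambda>t. f' (z + t *\<^sub>R b)"]) auto
  with g(1) that show thesis by blast
qed

section \<open>Sums of Newtonian kernels\<close>

text \<open>\<open>F (|x|\<^sup>2 + h\<^sup>2)\<close> is a regularised Newtonian kernel.  The bound with exponent \<open>(1 - m) / 2\<close>
  instead of \<open>(2 - m) / 2\<close> includes the logarithmic case \<open>m = 2\<close>.\<close>

lemma superharmonic_profile:
  fixes m T :: real
  assumes m: "m \<ge> 2" and T: "T > 0"
  obtains F where "\<And>t. t > 0 \<Longrightarrow> (F has_real_derivative - (t powr (- m / 2))) (at t)"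
    and "\<And>t. \<lbrakk>0 < t; t \<le> T\<rbrakk> \<Longrightarrow> 0 \<le> F t \<and> F t \<le> 2 * sqrt T * t powr ((1 - m) / 2)"
proof -
  obtain F0 where F0: "\<And>t::real. t > 0 \<Longrightarrow> (F0 has_real_derivative - (t powr (- m / 2))) (at t)"
  proof (cases "m = 2")
    case True
    show ?thesis
      by (rule that[of "\<lambda>t. - ln t"])
        (auto intro!: derivative_eq_intros simp: True powr_minus_divide powr_one_gt_zero_iff field_simps)
  next
    case False
    define p where "p = 1 - m / 2"
    have "((\<lambda>t. t powr p / (- p)) has_real_derivative - (t powr (- m / 2))) (at t)" if "t > 0" for t
    proof -
      have "((\<lambda>t. t powr p / (- p)) has_real_derivative (p * t powr (p - 1)) / (- p)) (at t)"
        by (intro DERIV_cdivide has_real_derivative_powr that)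
      moreover have "p - 1 = - m / 2" "p \<noteq> 0" using False by (auto simp: p_def)
      ultimately show ?thesis by simp
    qed
    then show ?thesis by (rule that)
  qed
  \<comment> \<open>The antiderivative decreases, so subtracting its value at T makes it nonnegative
    on (0, T].\<close>
  define F where "F t = F0 t - F0 T" for t
  have F: "(F has_real_derivative - (t powr (- m / 2))) (at t)" if "t > 0" for t
    unfolding F_def [abs_def] using F0[OF that] by (auto intro!: derivative_eq_intros)
  have FT: "F T = 0" by (simp add: F_def)
  \<comment> \<open>A majorant found by comparing slopes: on (0, T] the factor \<open>sqrt t\<close>
    in \<open>t powr (- m / 2)\<close> is replaced by \<open>sqrt T\<close>, so \<open>G - F\<close>
    is nonincreasing, and it is nonnegative at T.\<close>
  define G where "G t = 2 * sqrt T / (m - 1) * t powr ((1 - m) / 2)" for t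
  have G: "(G has_real_derivative - sqrt T * t powr ((1 - m) / 2 - 1)) (at t)" if "t > 0" for t
  proof -
    have "(G has_real_derivative 2 * sqrt T / (m - 1) * ((1 - m) / 2 * t powr ((1 - m) / 2 - 1))) (at t)"
      unfolding G_def [abs_def] by (intro DERIV_cmult has_real_derivative_powr that)
    moreover have "2 * sqrt T / (m - 1) * ((1 - m) / 2) = - sqrt T"
      using m by (simp add: field_simps)
    ultimately show ?thesis
      by (simp only: mult.assoc [symmetric])
  qed
  have "0 \<le> F t \<and> F t \<le> 2 * sqrt T * t powr ((1 - m) / 2)" if t: "0 < t" "t \<le> T" for t
  proof
    have "F T \<le> F t"
    proof (rule DERIV_nonpos_imp_nonincreasing[OF t(2)])
      fix x assume "t \<le> x" "x \<le> T"
      then show "\<exists>y. (F has_real_derivative y) (at x) \<and> y \<le> 0"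
        using F[of x] t by (intro exI[of _ "- (x powr (- m / 2))"]) auto
    qed
    then show "0 \<le> F t" by (simp add: FT)
    have "G T - F T \<le> G t - F t"
    proof (rule DERIV_nonpos_imp_nonincreasing[OF t(2)])
      fix x assume x: "t \<le> x" "x \<le> T"
      have "x powr (- m / 2) = sqrt x * x powr ((1 - m) / 2 - 1)"
        using x t by (simp add: powr_half_sqrt [symmetric] powr_add [symmetric] field_simps)
      also have "\<dots> \<le> sqrt T * x powr ((1 - m) / 2 - 1)"
        using x by (intro mult_right_mono) auto
      finally have "- sqrt T * x powr ((1 - m) / 2 - 1) - - (x powr (- m / 2)) \<le> 0" by simp
      moreover have "((\<lambda>x. G x - F x) has_real_derivative
          (- sqrt T * x powr ((1 - m) / 2 - 1) - - (x powr (- m / 2)))) (at x)"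
        using x t by (intro DERIV_diff G F) auto
      ultimately show "\<exists>y. ((\<lambda>x. G x - F x) has_real_derivative y) (at x) \<and> y \<le> 0" by blast
    qed
    moreover have "G T \<ge> 0" using m T by (simp add: G_def)
    ultimately have "F t \<le> G t" by (simp add: FT)
    also have "\<dots> \<le> 2 * sqrt T * t powr ((1 - m) / 2)"
    proof -
      have "2 * sqrt T / (m - 1) \<le> 2 * sqrt T"
        using m T by (simp add: divide_le_eq)
      then show ?thesis unfolding G_def by (intro mult_right_mono) auto
    qed
    finally show "F t \<le> 2 * sqrt T * t powr ((1 - m) / 2)" .
  qed
  with F that show thesis by blast
qed

lemma radial_second_difference:
  fixes F :: "real \<Rightarrow> real" and y z b :: "'a::euclidean_space"
  assumes F: "\<And>t. t > 0 \<Longrightarrow> (F has_real_derivative - (t powr (- m / 2))) (at t)"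
    and h: "h > 0" and b: "norm b = 1"
  shows "has_second_difference (\<lambda>x. F ((norm (x - y))\<^sup>2 + h\<^sup>2)) b z
    (- 2 * ((norm (z - y))\<^sup>2 + h\<^sup>2) powr (- m / 2)
     + 2 * m * ((z - y) \<bullet> b)\<^sup>2 * ((norm (z - y))\<^sup>2 + h\<^sup>2) powr (- m / 2 - 1))"
proof -
  define \<rho> where "\<rho> t = (norm (z + t *\<^sub>R b - y))\<^sup>2 + h\<^sup>2" for t
  define \<beta> where "\<beta> = (z - y) \<bullet> b"
  have \<rho>: "\<rho> t = (norm (z - y))\<^sup>2 + h\<^sup>2 + 2 * t * \<beta> + t\<^sup>2" for t
  proof -
    have "z + t *\<^sub>R b - y = (z - y) + t *\<^sub>R b" by simp
    moreover have "(norm (w + t *\<^sub>R b))\<^sup>2 = (norm w)\<^sup>2 + 2 * t * (w \<bullet> b) + t\<^sup>2" for w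
      using b by (simp add: power2_norm_eq_inner inner_add_left inner_add_right inner_commute norm_eq_1
          power2_eq_square[of t])
    ultimately show ?thesis by (simp only: \<rho>_def \<beta>_def)
  qed
  have pos: "\<rho> t > 0" for t using h by (simp add: \<rho>_def add_nonneg_pos)
  have D\<rho>: "(\<rho> has_real_derivative 2 * \<beta> + 2 * t) (at t)" for t
    unfolding \<rho> [abs_def] by (auto intro!: derivative_eq_intros)
  have 1: "((\<lambda>t. F (\<rho> t)) has_real_derivative - (\<rho> t powr (- m / 2)) * (2 * \<beta> + 2 * t)) (at t)" for t
    by (rule DERIV_chain2[OF F[OF pos] D\<rho>])
  have 2: "((\<lambda>t. - (\<rho> t powr (- m / 2)) * (2 * \<beta> + 2 * t)) has_real_derivative
      (- 2 * \<rho> 0 powr (- m / 2) + 2 * m * \<beta>\<^sup>2 * \<rho> 0 powr (- m / 2 - 1))) (at 0)"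
    using pos[of 0]
    by (auto intro!: derivative_eq_intros D\<rho>[of 0] simp: power2_eq_square algebra_simps)
  show ?thesis
    using has_second_differenceI[OF always_eventually 2, of "\<lambda>x. F ((norm (x - y))\<^sup>2 + h\<^sup>2)" z b] 1
    by (simp add: \<rho>_def \<beta>_def)
qed

text \<open>The exponent \<open>- m / 2\<close> is the one for which the kernel with h = 0 is
  harmonic off its pole: the terms of size |z - y|^2 cancel and only h^2 survives. The Laplacian is
  therefore negative everywhere, and of order h^(-m) within distance of order h from y.\<close>

lemma radial_laplacian:
  fixes y z :: "'a::euclidean_space"
  assumes "h > 0" and m: "m = real DIM('a)"
  shows "(\<Sum>b\<in>Basis. - 2 * ((norm (z - y))\<^sup>2 + h\<^sup>2) powr (- m / 2)
     + 2 * m * ((z - y) \<bullet> b)\<^sup>2 * ((norm (z - y))\<^sup>2 + h\<^sup>2) powr (- m / 2 - 1))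
   = - 2 * m * h\<^sup>2 * ((norm (z - y))\<^sup>2 + h\<^sup>2) powr (- m / 2 - 1)"
proof -
  define R where "R = (norm (z - y))\<^sup>2 + h\<^sup>2"
  have R: "R > 0" using assms by (simp add: R_def add_nonneg_pos)
  have "(\<Sum>b\<in>Basis. ((z - y) \<bullet> b)\<^sup>2) = (norm (z - y))\<^sup>2"
    unfolding power2_norm_eq_inner
    by (subst euclidean_inner[of "z - y" "z - y"]) (simp add: power2_eq_square)
  moreover have "(\<Sum>b\<in>Basis. - 2 * R powr (- m / 2) + 2 * m * ((z - y) \<bullet> b)\<^sup>2 * R powr (- m / 2 - 1))
     = - 2 * m * R powr (- m / 2)
       + 2 * m * (\<Sum>b\<in>Basis. ((z - y) \<bullet> b)\<^sup>2) * R powr (- m / 2 - 1)"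
    unfolding sum.distrib sum_distrib_left sum_distrib_right by (simp add: m)
  ultimately have S: "(\<Sum>b\<in>Basis. - 2 * R powr (- m / 2) + 2 * m * ((z - y) \<bullet> b)\<^sup>2 * R powr (- m / 2 - 1))
     = - 2 * m * R powr (- m / 2) + 2 * m * (norm (z - y))\<^sup>2 * R powr (- m / 2 - 1)"
    by simp
  have P: "R powr (- m / 2) = R * R powr (- m / 2 - 1)"
    using R by (simp add: powr_diff)
  show ?thesis
    unfolding R_def [symmetric] S unfolding P by (simp add: R_def algebra_simps)
qed

section \<open>Separated nets and packing\<close>

lemma finite_separated_net:
  fixes E :: "'a::metric_space set"
  assumes "compact E" and h: "h > 0"
  obtains S where "finite S" "S \<subseteq> E" "\<And>x y. \<lbrakk>x \<in> S; y \<in> S; x \<noteq> y\<rbrakk> \<Longrightarrow> h \<le> dist x y"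
    "E \<subseteq> (\<Union>x\<in>S. ball x h)"
proof -
  define sep where "sep S \<longleftrightarrow> finite S \<and> S \<subseteq> E \<and> (\<forall>x\<in>S. \<forall>y\<in>S. x \<noteq> y \<longrightarrow> h \<le> dist x y)" for S
  \<comment> \<open>Half the radius, so that two points of a separated set never share a ball; the
    number of balls then bounds the size of every separated set.\<close>
  obtain C where C: "finite C" "E \<subseteq> (\<Union>c\<in>C. ball c (h / 2))"
    using compact_eq_totally_bounded[of E] assms by (meson half_gt_zero)
  have bound: "card S \<le> card C" if S: "sep S" for S
  proof -
    have "S \<subseteq> (\<Union>c\<in>C. ball c (h / 2))" using S C(2) by (auto simp only: sep_def)
    then have "\<forall>x\<in>S. \<exists>c\<in>C. dist c x < h / 2" unfolding subset_iff UN_iff mem_ball by blast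
    then obtain c where c: "\<And>x. x \<in> S \<Longrightarrow> c x \<in> C \<and> dist (c x) x < h / 2"
      by metis
    have "inj_on c S"
    proof (rule inj_onI, rule ccontr)
      fix x y assume *: "x \<in> S" "y \<in> S" "c x = c y" "x \<noteq> y"
      have "dist x y \<le> dist (c x) x + dist (c x) y" by (metis dist_triangle3)
      also have "\<dots> < h" using c[of x] c[of y] * by auto
      finally have "dist x y < h" .
      then show False using *(1,2,4) S unfolding sep_def by (meson not_less)
    qed
    then show ?thesis using c C(1) by (meson card_inj_on_le image_subsetI)
  qed
  have "sep {}" by (simp add: sep_def)
  \<comment> \<open>A separated set of greatest cardinality covers E, because a point missed by all
    its balls could be added to it.\<close>
  from ex_has_greatest_nat[of sep "{}" card "Suc (card C)", OF this]
  obtain S where S: "sep S" "\<And>T. sep T \<Longrightarrow> card T \<le> card S"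
    using bound by (auto simp: le_imp_less_Suc)
  have "E \<subseteq> (\<Union>x\<in>S. ball x h)"
  proof (rule ccontr)
    assume "\<not> ?thesis"
    then obtain y where "y \<in> E" "y \<notin> (\<Union>x\<in>S. ball x h)"
      by blast
    then have y: "y \<in> E" "\<And>x. x \<in> S \<Longrightarrow> h \<le> dist x y"
      by (auto simp: not_less)
    then have "y \<notin> S" using h by force
    moreover have "sep (insert y S)"
      using S(1) y by (auto simp: sep_def dist_commute)
    ultimately show False
      using S(2)[of "insert y S"] S(1)[unfolded sep_def] by simp
  qed
  then show thesis
    using S(1)[unfolded sep_def] by (elim conjE) (rule that, assumption+, blast, assumption)
qed

text \<open>Balls of half the separation distance are pairwise disjoint, so their volumes add up
  inside T.\<close>

lemma separated_packing:
  fixes S :: "'a::euclidean_space set"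
  assumes S: "finite S" "\<And>x y. \<lbrakk>x \<in> S; y \<in> S; x \<noteq> y\<rbrakk> \<Longrightarrow> h \<le> dist x y" and h: "h > 0"
    and T: "T \<in> lmeasurable" "\<And>x. x \<in> S \<Longrightarrow> ball x (h / 2) \<subseteq> T"
  shows "real (card S) * ((h / 2) ^ DIM('a) * measure lborel (ball (0::'a) 1)) \<le> measure lebesgue T"
proof -
  have disj: "disjoint_family_on (\<lambda>x. ball x (h / 2)) S"
  proof (unfold disjoint_family_on_def, intro ballI impI)
    fix x y assume *: "x \<in> S" "y \<in> S" "x \<noteq> y"
    show "ball x (h / 2) \<inter> ball y (h / 2) = {}"
      by (rule disjoint_ballI) (use S(2)[OF *] in simp)
  qed
  have "measure lebesgue (\<Union>x\<in>S. ball x (h / 2)) = (\<Sum>x\<in>S. measure lebesgue (ball x (h / 2)))"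
    by (rule measure_finite_Union[OF S(1) _ disj])
      (use fmeasurableD2[OF lmeasurable_ball] in auto)
  also have "\<dots> = real (card S) * ((h / 2) ^ DIM('a) * measure lborel (ball (0::'a) 1))"
    using h by (simp add: content_ball_conv_unit_ball[of "h / 2"])
  finally have "real (card S) * ((h / 2) ^ DIM('a) * measure lborel (ball (0::'a) 1))
      = measure lebesgue (\<Union>x\<in>S. ball x (h / 2))" ..
  also have "\<dots> \<le> measure lebesgue T"
    using T S(1) by (intro measure_mono_fmeasurable) auto
  finally show ?thesis .
qed

text \<open>Concavity of N^(1/m): its last increment is at least its derivative at N. With x = 1 / N
  this is Bernoulli's inequality. It lets the sum of k^(1/m - 1) telescope in
  \<open>separated_kernel_sum\<close>.\<close>

lemma powr_inverse_difference:
  fixes N :: real and m :: nat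
  assumes N: "N \<ge> 1" and m: "m \<ge> 1"
  shows "(N - 1) powr (1 / m) + N powr (1 / m - 1) / m \<le> N powr (1 / m)"
proof -
  define x where "x = 1 / N"
  have x: "0 \<le> x" "x \<le> 1" using N by (auto simp: x_def)
  have xm: "x / m \<le> 1" using x m by (simp add: divide_le_eq)
  have "1 - x \<le> (1 - x / m) ^ m"
    using Bernoulli_inequality[of "- (x / m)" m] xm m by simp
  then have "(1 - x) powr (1 / m) \<le> ((1 - x / m) ^ m) powr (1 / m)"
    using x by (intro powr_mono2) auto
  also have "\<dots> = 1 - x / m"
    \<comment> \<open>The base vanishes only for N = m = 1, where \<open>powr_realpow\<close> does
      not apply.\<close>
    using xm m by (cases "x / m = 1") (auto simp: powr_realpow [symmetric] powr_powr)
  finally have "N powr (1 / m) * (1 - x) powr (1 / m) \<le> N powr (1 / m) * (1 - x / m)"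
    by (intro mult_left_mono) auto
  also have "N powr (1 / m) * (1 - x) powr (1 / m) = (N - 1) powr (1 / m)"
  proof -
    have "N * (1 - x) = N - 1" using N by (simp add: x_def right_diff_distrib)
    then show ?thesis using N x by (subst powr_mult [symmetric]) auto
  qed
  also have "N powr (1 / m) * (1 - x / m) = N powr (1 / m) - N powr (1 / m - 1) / m"
    using N by (simp add: x_def powr_diff algebra_simps)
  finally show ?thesis by simp
qed

text \<open>By volume, the \<open>N\<close>-th closest point of a separated set has distance at least of order
  \<open>h N\<^bsup>1/m\<^esup>\<close>; the induction removes the farthest point.\<close>

lemma separated_kernel_sum:
  fixes S :: "'a::euclidean_space set"
  assumes "finite S" "\<And>x y. \<lbrakk>x \<in> S; y \<in> S; x \<noteq> y\<rbrakk> \<Longrightarrow> h \<le> dist x y" and h: "h > 0"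
    and m: "m = DIM('a)"
  shows "(\<Sum>x\<in>S. h ^ m * ((norm (z - x))\<^sup>2 + h\<^sup>2) powr ((1 - real m) / 2))
     \<le> real m * (2 * sqrt 2) ^ (m - 1) * h * real (card S) powr (1 / real m)"
  using assms(1,2)
proof (induction "card S" arbitrary: S)
  case 0
  then show ?case by simp
next
  case (Suc k)
  define N where "N = real (card S)"
  define K where "K = (2 * sqrt 2) ^ (m - 1)"
  have m1: "m \<ge> 1" by (simp add: m DIM_positive Suc_leI)
  have N: "N \<ge> 1" using Suc.hyps(2) by (simp add: N_def)
  have "S \<noteq> {}" using Suc.hyps(2) by auto
  then have "Max (dist z ` S) \<in> dist z ` S"
    using Suc.prems(1) by (intro Max_in) auto
  then obtain x where "x \<in> S" and Max: "Max (dist z ` S) = dist z x"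
    by blast
  then have x: "x \<in> S" "\<And>y. y \<in> S \<Longrightarrow> dist z y \<le> dist z x"
    using Suc.prems(1) by (auto simp flip: Max)
  define d where "d = dist z x"
  have d: "d \<ge> 0" by (simp add: d_def)
  \<comment> \<open>No point is farther than d from z, so all N disjoint balls fit into one ball of
    radius \<open>d + h / 2\<close>.\<close>
  have "N * ((h / 2) ^ m * measure lborel (ball (0::'a) 1)) \<le> measure lebesgue (ball z (d + h / 2))"
    unfolding N_def m
  proof (rule separated_packing[OF Suc.prems h])
    fix y assume y: "y \<in> S"
    show "ball y (h / 2) \<subseteq> ball z (d + h / 2)"
      by (rule ball_subset_ball_iff[THEN iffD2]) (use x(2)[OF y] in \<open>simp add: d_def dist_commute\<close>)
  qed auto
  also have "\<dots> = (d + h / 2) ^ m * measure lborel (ball (0::'a) 1)"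
    using d h m by (simp add: content_ball_conv_unit_ball[of "d + h / 2" z])
  finally have "N * (h / 2) ^ m \<le> (d + h / 2) ^ m"
    using content_ball_pos[of 1 "0::'a"] by simp
  then have "(N * (h / 2) ^ m) powr (1 / m) \<le> ((d + h / 2) ^ m) powr (1 / m)"
    using N h by (intro powr_mono2) auto
  then have *: "N powr (1 / m) * (h / 2) \<le> d + h / 2"
  proof -
    have "(x ^ m) powr (1 / m) = x" if "x > 0" for x :: real
      using that m1 by (simp add: powr_realpow [symmetric] powr_powr)
    then have "((d + h / 2) ^ m) powr (1 / m) = d + h / 2" "((h / 2) ^ m) powr (1 / m) = h / 2"
      using d h by (auto simp: add_nonneg_pos)
    moreover have "(N * (h / 2) ^ m) powr (1 / m) = N powr (1 / m) * ((h / 2) ^ m) powr (1 / m)"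
      by (rule powr_mult)
    ultimately show ?thesis
      using \<open>(N * (h / 2) ^ m) powr (1 / m) \<le> _\<close> by (simp only:)
  qed
  \<comment> \<open>The packing bound says that \<open>d + h / 2\<close> is at least
    \<open>sqrt 2 * w\<close>; together with
    \<open>(d + h / 2)\<^sup>2 \<le> 2 * (d\<^sup>2 + h\<^sup>2)\<close> it gives
    \<open>w\<^sup>2 \<le> d\<^sup>2 + h\<^sup>2\<close>. The constant \<open>2 * sqrt 2\<close> in
    the statement comes from here.\<close>
  define w where "w = N powr (1 / m) * h / (2 * sqrt 2)"
  have w: "w > 0" using N h by (simp add: w_def)
  have "w\<^sup>2 = (N powr (1 / m) * (h / 2))\<^sup>2 / 2"
    by (simp add: w_def power_divide power_mult_distrib)
  also have "\<dots> \<le> (d + h / 2)\<^sup>2 / 2"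
    using * N h by (intro divide_right_mono power_mono) auto
  also have "\<dots> \<le> d\<^sup>2 + h\<^sup>2"
  proof -
    have "(d - h / 2)\<^sup>2 + (d + h / 2)\<^sup>2 = 2 * d\<^sup>2 + h\<^sup>2 / 2"
      by (simp add: power2_eq_square algebra_simps)
    moreover have "0 \<le> (d - h / 2)\<^sup>2" "0 \<le> h\<^sup>2" by simp_all
    ultimately show ?thesis by linarith
  qed
  finally have "w\<^sup>2 \<le> d\<^sup>2 + h\<^sup>2" .
  then have "(d\<^sup>2 + h\<^sup>2) powr ((1 - real m) / 2) \<le> (w\<^sup>2) powr ((1 - real m) / 2)"
    using w m1 by (intro powr_mono2') auto
  also have "\<dots> = w powr (1 - real m)"
  proof -
    have "w\<^sup>2 = w powr 2" using w by simp
    moreover have "2 * ((1 - real m) / 2) = 1 - real m" by simp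
    ultimately show ?thesis by (simp only: powr_powr)
  qed
  also have "\<dots> = N powr (1 / m - 1) * h powr (1 - real m) * K"
  proof -
    have "w powr (1 - real m) = (N powr (1 / m)) powr (1 - real m) * h powr (1 - real m) * inverse ((2 * sqrt 2) powr (1 - real m))"
      by (simp only: w_def powr_divide powr_mult[of "N powr (1 / m)" h]) (rule divide_inverse)
    also have "(N powr (1 / m)) powr (1 - real m) = N powr (1 / m - 1)"
      using m1 by (simp add: powr_powr field_simps)
    also have "inverse ((2 * sqrt 2) powr (1 - real m)) = K"
    proof -
      have "inverse ((2 * sqrt 2) powr (1 - real m)) = (2 * sqrt 2) powr (real (m - 1))"
        using m1 by (simp add: powr_minus [symmetric] of_nat_diff)
      then show ?thesis by (simp only: K_def) (simp add: powr_realpow)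
    qed
    finally show ?thesis .
  qed
  finally have "h ^ m * (d\<^sup>2 + h\<^sup>2) powr ((1 - real m) / 2)
      \<le> h ^ m * (N powr (1 / m - 1) * h powr (1 - real m) * K)"
    using h by (intro mult_left_mono) auto
  also have "\<dots> = h * K * N powr (1 / m - 1)"
  proof -
    have "h ^ m * h powr (1 - real m) = h"
      using h by (simp add: powr_realpow [symmetric] powr_add [symmetric])
    then show ?thesis by (metis mult.assoc mult.commute)
  qed
  finally have far: "h ^ m * (d\<^sup>2 + h\<^sup>2) powr ((1 - real m) / 2) \<le> h * K * N powr (1 / m - 1)" .
  have card': "card (S - {x}) = k" using Suc.hyps(2) x(1) Suc.prems(1) by simp
  have IH: "(\<Sum>y\<in>S - {x}. h ^ m * ((norm (z - y))\<^sup>2 + h\<^sup>2) powr ((1 - real m) / 2))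
     \<le> real m * K * h * (N - 1) powr (1 / real m)"
    using Suc.hyps(1)[of "S - {x}"] Suc.prems card' Suc.hyps(2)
    by (simp add: K_def N_def flip: Suc.hyps(2))
  have "(\<Sum>y\<in>S. h ^ m * ((norm (z - y))\<^sup>2 + h\<^sup>2) powr ((1 - real m) / 2))
     = h ^ m * (d\<^sup>2 + h\<^sup>2) powr ((1 - real m) / 2)
       + (\<Sum>y\<in>S - {x}. h ^ m * ((norm (z - y))\<^sup>2 + h\<^sup>2) powr ((1 - real m) / 2))"
    using x(1) Suc.prems(1) by (simp add: sum.remove d_def dist_norm)
  also have "\<dots> \<le> h * K * N powr (1 / m - 1) + real m * K * h * (N - 1) powr (1 / real m)"
    using far IH by (rule add_mono)
  \<comment> \<open>The farthest point costs exactly the increment that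
    \<open>powr_inverse_difference\<close> leaves between N - 1 and N.\<close>
  also have "\<dots> = real m * K * h * ((N - 1) powr (1 / real m) + N powr (1 / m - 1) / m)"
    using m1 by (simp add: algebra_simps)
  also have "\<dots> \<le> real m * K * h * N powr (1 / real m)"
    using powr_inverse_difference[OF N m1] h by (intro mult_left_mono) (auto simp: K_def)
  finally show ?case by (simp add: K_def N_def)
qed

text \<open>Each kernel of the net pushes the Laplacian to - L on a ball about its own centre, and
  the remaining kernels can only lower it further. The height of the sum is controlled by the volume
  of a neighbourhood V of E, which is as small as desired since E is null.\<close>

lemma small_superharmonic_function:
  fixes E :: "'a::euclidean_space set"
  assumes dim: "DIM('a) \<ge> 2" and E: "compact E" "negligible E" "E \<subseteq> cball 0 R"
    and L: "L > 0" and \<epsilon>: "\<epsilon> > 0"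
  obtains W s e where "open W" "E \<subseteq> W" "continuous_on UNIV s"
    "\<And>z. norm z \<le> R \<Longrightarrow> 0 \<le> s z \<and> s z \<le> \<epsilon>"
    "\<And>b z. b \<in> Basis \<Longrightarrow> has_second_difference s b z (e b z)"
    "\<And>z. (\<Sum>b\<in>Basis. e b z) \<le> 0" "\<And>z. z \<in> W \<Longrightarrow> (\<Sum>b\<in>Basis. e b z) \<le> - L"
proof -
  define m where "m = DIM('a)"
  \<comment> \<open>Bounds every argument \<open>w x z\<close> of the profile when x and z lie in
    \<open>cball 0 R\<close> and h is at most 1.\<close>
  define T where "T = (2 * R)\<^sup>2 + 1"
  \<comment> \<open>Solves \<open>A * 2 * m * 5 powr (- (m / 2 + 1)) = L\<close>. The 5 is 2^2 + 1:
    within distance 2 h of a centre, the argument of the profile is at most 5 h^2.\<close>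
  define A where "A = L * 5 powr (m / 2 + 1) / (2 * real m)"
  define K where "K = A * (2 * sqrt T) * (m * (2 * sqrt 2) ^ (m - 1))"
  define \<omega> where "\<omega> = measure lborel (ball (0::'a) 1)"
  have m: "m \<ge> 2" using dim by (simp add: m_def)
  have T: "T > 0" by (simp add: T_def add_nonneg_pos)
  have A: "A > 0" using L m by (simp add: A_def)
  have K: "K > 0" using A T m by (simp add: K_def)
  have \<omega>: "\<omega> > 0" by (simp add: \<omega>_def content_ball_pos)
  \<comment> \<open>Chosen so that packing into volume v forces
    \<open>N powr (1 / m) * h \<le> \<epsilon> / K\<close> for every h. Hence v can be fixed before
    V, and h can then be adapted to V.\<close>
  define v where "v = \<omega> * (\<epsilon> / (2 * K)) ^ m"
  have v: "v > 0" using \<omega> \<epsilon> K by (simp add: v_def)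
  obtain F where F: "\<And>t. t > 0 \<Longrightarrow> (F has_real_derivative - (t powr (- real m / 2))) (at t)"
    and F_bounds: "\<And>t. \<lbrakk>0 < t; t \<le> T\<rbrakk> \<Longrightarrow> 0 \<le> F t \<and> F t \<le> 2 * sqrt T * t powr ((1 - real m) / 2)"
    using superharmonic_profile[of "real m" T] m T by auto
  obtain V where V: "open V" "E \<subseteq> V" "V \<in> lmeasurable" "measure lebesgue V \<le> v"
  proof -
    have "E \<in> lmeasurable" using E(2) by (simp add: negligible_imp_measurable)
    then obtain V where V: "open V" "E \<subseteq> V" "V - E \<in> lmeasurable" "emeasure lebesgue (V - E) < ennreal v"
      using sets_lebesgue_outer_open[OF _ v] by blast
    have VE: "(V - E) \<union> E = V" using V(2) by blast
    have "V \<in> lmeasurable"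
      using fmeasurable.Un[OF V(3) \<open>E \<in> lmeasurable\<close>] by (simp only: VE)
    moreover have "measure lebesgue V = measure lebesgue (V - E)"
      using V(3) E(2) measure_Un_null_set[of "V - E" lebesgue E]
      by (simp only: VE negligible_iff_null_sets fmeasurableD)
    moreover have "measure lebesgue (V - E) \<le> v"
      using V(3,4) v by (simp add: emeasure_eq_measure2 ennreal_less_iff)
    ultimately show thesis using V(1,2) that by simp
  qed
  obtain \<delta> where \<delta>: "\<delta> > 0" "(\<Union>x\<in>E. ball x \<delta>) \<subseteq> V"
    using compact_subset_open_imp_ball_epsilon_subset[OF E(1) V(1,2)] .
  \<comment> \<open>The bound by \<delta> keeps the packed balls inside V; the bound by 1 is the one
    that T presupposes.\<close>
  define h where "h = min 1 \<delta>"
  have h: "h > 0" "h \<le> 1" "h \<le> \<delta>" using \<delta> by (auto simp: h_def)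
  obtain S where S: "finite S" "S \<subseteq> E" "\<And>x y. \<lbrakk>x \<in> S; y \<in> S; x \<noteq> y\<rbrakk> \<Longrightarrow> h \<le> dist x y"
    "E \<subseteq> (\<Union>x\<in>S. ball x h)"
    using finite_separated_net[OF E(1) h(1)] by metis
  define N where "N = real (card S)"
  define w where "w x z = (norm (z - x))\<^sup>2 + h\<^sup>2" for x z :: 'a
  have w: "w x z > 0" for x z using h by (simp add: w_def add_nonneg_pos)
  define s where "s z = (\<Sum>x\<in>S. (A * h ^ m) * F (w x z))" for z
  define e' where "e' b z x = - 2 * w x z powr (- real m / 2)
     + 2 * real m * ((z - x) \<bullet> b)\<^sup>2 * w x z powr (- real m / 2 - 1)" for b z x
  define e where "e b z = (\<Sum>x\<in>S. (A * h ^ m) * e' b z x)" for b z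
  define W where "W = (\<Union>x\<in>S. ball x (2 * h))"
  have small: "N powr (1 / m) * h \<le> \<epsilon> / K"
  proof -
    have "N * ((h / 2) ^ m * \<omega>) \<le> measure lebesgue V"
      unfolding N_def m_def \<omega>_def
    proof (rule separated_packing[OF S(1,3) h(1) V(3)])
      fix x assume "x \<in> S"
      then have "ball x \<delta> \<subseteq> V" using \<delta> S(2) by blast
      moreover have "ball x (h / 2) \<subseteq> ball x \<delta>" using h by (intro subset_ball) auto
      ultimately show "ball x (h / 2) \<subseteq> V" by blast
    qed
    also have "\<dots> \<le> (\<epsilon> / (2 * K)) ^ m * \<omega>" using V(4) by (simp add: v_def mult.commute)
    finally have "N * (h / 2) ^ m \<le> (\<epsilon> / (2 * K)) ^ m"
      using \<omega> by simp
    then have *: "(N * (h / 2) ^ m) powr (1 / m) \<le> ((\<epsilon> / (2 * K)) ^ m) powr (1 / m)"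
      using h by (intro powr_mono2) (auto simp: N_def)
    have root: "(x ^ m) powr (1 / m) = x" if "x > 0" for x :: real
      using that m by (simp add: powr_realpow [symmetric] powr_powr)
    have "N powr (1 / m) * (h / 2) \<le> \<epsilon> / (2 * K)"
      using * root[of "h / 2"] root[of "\<epsilon> / (2 * K)"] h \<epsilon> K by (simp add: powr_mult)
    then show ?thesis by simp
  qed
  have e: "has_second_difference s b z (e b z)" if b: "b \<in> Basis" for b z
    unfolding s_def [abs_def] e_def
  proof (intro has_second_difference_sum[OF S(1)] has_second_difference_cmult)
    fix x assume "x \<in> S"
    show "has_second_difference (\<lambda>z. F (w x z)) b z (e' b z x)"
      unfolding w_def e'_def by (intro radial_second_difference F h) (use b in auto)
  qed
  have lap: "(\<Sum>b\<in>Basis. e b z) = (\<Sum>x\<in>S. (A * h ^ m) * (- 2 * real m * h\<^sup>2 * w x z powr (- real m / 2 - 1)))" for z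
  proof -
    have "(\<Sum>b\<in>Basis. e b z) = (\<Sum>x\<in>S. (A * h ^ m) * (\<Sum>b\<in>Basis. e' b z x))"
      unfolding e_def sum_distrib_left by (rule sum.swap)
    moreover have "(\<Sum>b\<in>Basis. e' b z x) = - 2 * real m * h\<^sup>2 * w x z powr (- real m / 2 - 1)" for x
      unfolding e'_def w_def by (rule radial_laplacian) (use h in \<open>auto simp: m_def\<close>)
    ultimately show ?thesis by simp
  qed
  have nonpos: "(A * h ^ m) * (- 2 * real m * h\<^sup>2 * w x z powr (- real m / 2 - 1)) \<le> 0" for x z
  proof -
    have "0 \<le> (A * h ^ m) * (2 * real m * h\<^sup>2 * w x z powr (- real m / 2 - 1))"
      using A h by (intro mult_nonneg_nonneg) auto
    then show ?thesis by simp
  qed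
  show thesis
  proof (rule that[of W s e])
    show "open W" unfolding W_def by (intro open_UN ballI open_ball)
    show "E \<subseteq> W"
    proof -
      have "ball x h \<subseteq> ball x (2 * h)" for x :: 'a using h by (intro subset_ball) auto
      then show ?thesis using S(4) unfolding W_def by blast
    qed
    have "continuous_on {0<..} F"
      by (meson F DERIV_isCont continuous_at_imp_continuous_on greaterThan_iff)
    then have "continuous_on UNIV (\<lambda>z. F (w x z))" for x
      by (rule continuous_on_compose2[where t = "{0<..}"])
        (use w in \<open>auto simp: w_def intro!: continuous_intros\<close>)
    then show "continuous_on UNIV s"
      unfolding s_def [abs_def] by (intro continuous_intros) auto
    show "0 \<le> s z \<and> s z \<le> \<epsilon>" if z: "norm z \<le> R" for z
    proof -
      have wT: "w x z \<le> T" if "x \<in> S" for x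
      proof -
        have "norm x \<le> R" using that S(2) E(3) by auto
        then have "norm (z - x) \<le> 2 * R" using z norm_triangle_ineq4[of z x] by linarith
        then have "(norm (z - x))\<^sup>2 \<le> (2 * R)\<^sup>2" by (intro power_mono) auto
        moreover have "h\<^sup>2 \<le> 1" using h by (simp add: power_le_one)
        ultimately show ?thesis by (simp add: w_def T_def)
      qed
      have nonneg: "0 \<le> s z"
        unfolding s_def using A h wT w F_bounds by (intro sum_nonneg mult_nonneg_nonneg) auto
      have "s z \<le> (\<Sum>x\<in>S. (A * h ^ m) * (2 * sqrt T * w x z powr ((1 - real m) / 2)))"
        unfolding s_def using A h wT w F_bounds by (intro sum_mono mult_left_mono) auto
      also have "\<dots> = A * (2 * sqrt T) * (\<Sum>x\<in>S. h ^ m * w x z powr ((1 - real m) / 2))"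
        by (simp add: sum_distrib_left mult_ac)
      also have "\<dots> \<le> A * (2 * sqrt T) * (real m * (2 * sqrt 2) ^ (m - 1) * h * N powr (1 / m))"
        unfolding w_def N_def
        using A T by (intro mult_left_mono separated_kernel_sum[OF S(1,3) h(1) m_def]) auto
      also have "\<dots> = K * (N powr (1 / m) * h)" by (simp add: K_def mult_ac)
      also have "\<dots> \<le> K * (\<epsilon> / K)" using small K by (intro mult_left_mono) auto
      also have "\<dots> = \<epsilon>" using K by simp
      finally show ?thesis using nonneg by blast
    qed
    show "has_second_difference s b z (e b z)" if "b \<in> Basis" for b z using e that .
    show "(\<Sum>b\<in>Basis. e b z) \<le> 0" for z
      unfolding lap by (intro sum_nonpos nonpos)
    show "(\<Sum>b\<in>Basis. e b z) \<le> - L" if "z \<in> W" for z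
    proof -
      obtain x where x: "x \<in> S" "dist x z < 2 * h" using \<open>z \<in> W\<close> unfolding W_def UN_iff mem_ball by blast
      have "(norm (z - x))\<^sup>2 \<le> (2 * h)\<^sup>2"
        using x(2) by (intro power_mono) (auto simp: dist_norm norm_minus_commute)
      then have w5: "w x z \<le> 5 * h\<^sup>2" by (simp add: w_def power_mult_distrib)
      have "(5 * h\<^sup>2) powr (- real m / 2 - 1) \<le> w x z powr (- real m / 2 - 1)"
        using w w5 by (intro powr_mono2') auto
      moreover have "(5 * h\<^sup>2) powr (- real m / 2 - 1) = 5 powr (- (real m / 2 + 1)) * h powr (- real m - 2)"
      proof -
        have "h\<^sup>2 = h powr 2" using h by simp
        moreover have "2 * (- real m / 2 - 1) = - real m - 2" "- real m / 2 - 1 = - (real m / 2 + 1)" by simp_all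
        ultimately show ?thesis by (simp only: powr_mult powr_powr)
      qed
      ultimately have "5 powr (- (real m / 2 + 1)) * h powr (- real m - 2) \<le> w x z powr (- real m / 2 - 1)"
        by simp
      then have "(A * h ^ m) * (- 2 * real m * h\<^sup>2 * w x z powr (- real m / 2 - 1))
          \<le> (A * h ^ m) * (- 2 * real m * h\<^sup>2 * (5 powr (- (real m / 2 + 1)) * h powr (- real m - 2)))"
        using A h by (intro mult_left_mono mult_left_mono_neg) auto
      also have "\<dots> = - L"
      proof -
        have "h ^ m * h\<^sup>2 * h powr (- real m - 2) = 1"
        proof -
          have "h ^ m = h powr m" "h\<^sup>2 = h powr 2" using h by (simp_all add: powr_realpow)
          then show ?thesis using h by (simp only: powr_add [symmetric]) simp
        qed
        moreover have "5 powr (- (real m / 2 + 1)) * 5 powr (real m / 2 + 1) = 1"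
          by (simp only: powr_add [symmetric]) simp
        moreover have "(A * h ^ m) * (- 2 * real m * h\<^sup>2 * (5 powr (- (real m / 2 + 1)) * h powr (- real m - 2)))
          = - L * (h ^ m * h\<^sup>2 * h powr (- real m - 2)) * (5 powr (- (real m / 2 + 1)) * 5 powr (real m / 2 + 1))"
          using m by (simp add: A_def)
        ultimately show ?thesis by simp
      qed
      finally have "(A * h ^ m) * (- 2 * real m * h\<^sup>2 * w x z powr (- real m / 2 - 1)) \<le> - L" .
      \<comment> \<open>Only the kernel centred at the nearby net point x is kept; the others
        contribute nonpositive terms.\<close>
      moreover have "(\<Sum>b\<in>Basis. e b z) \<le> (A * h ^ m) * (- 2 * real m * h\<^sup>2 * w x z powr (- real m / 2 - 1))"
      proof -
        have "(\<Sum>y\<in>S - {x}. (A * h ^ m) * (- 2 * real m * h\<^sup>2 * w y z powr (- real m / 2 - 1))) \<le> 0"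
          by (intro sum_nonpos nonpos)
        then show ?thesis unfolding lap using S(1) x(1) by (simp add: sum.remove)
      qed
      ultimately show ?thesis by linarith
    qed
  qed
qed

section \<open>The complex Hessian\<close>

lemma directional_derivative:
  fixes q :: "'a::real_normed_vector \<Rightarrow> real"
  assumes "q differentiable (at (x + t *\<^sub>R v))"
  shows "((\<lambda>t. q (x + t *\<^sub>R v)) has_real_derivative frechet_derivative q (at (x + t *\<^sub>R v)) v) (at t)"
proof -
  have D: "(q has_derivative frechet_derivative q (at (x + t *\<^sub>R v))) (at (x + t *\<^sub>R v))"
    using assms by (simp add: frechet_derivative_works)
  have "((\<lambda>t. x + t *\<^sub>R v) has_derivative (\<lambda>t. t *\<^sub>R v)) (at t)"
    by (auto intro!: derivative_eq_intros)
  from has_derivative_compose[OF this D]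
  have "((\<lambda>t. q (x + t *\<^sub>R v)) has_derivative (\<lambda>s. frechet_derivative q (at (x + t *\<^sub>R v)) (s *\<^sub>R v))) (at t)" .
  moreover have "frechet_derivative q (at (x + t *\<^sub>R v)) (s *\<^sub>R v) = frechet_derivative q (at (x + t *\<^sub>R v)) v * s" for s
    using linear_scale[OF has_derivative_linear[OF D]] by simp
  ultimately show ?thesis
    by (simp add: has_field_derivative_def)
qed

definition mixed_derivative ::
    "('a::real_normed_vector \<Rightarrow> real) \<Rightarrow> 'a \<Rightarrow> 'a \<Rightarrow> 'a \<Rightarrow> real" where
  "mixed_derivative q v w x = frechet_derivative (\<lambda>y. frechet_derivative q (at y) v) (at x) w"

lemma Ck_on_2D:
  assumes "Ck_on 2 q U"
  shows "x \<in> U \<Longrightarrow> q differentiable (at x)"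
    and "x \<in> U \<Longrightarrow> (\<lambda>y. frechet_derivative q (at y) v) differentiable (at x)"
    and "continuous_on U (mixed_derivative q v w)"
  using assms by (simp_all add: numeral_2_eq_2 mixed_derivative_def [abs_def])

text \<open>The mean value theorem, used first along v and then along w, turns the difference over a
  parallelogram into h^2 times the mixed derivative at an interior point, which tends to z.\<close>

lemma mixed_difference_tendsto:
  fixes q :: "'a::real_normed_vector \<Rightarrow> real"
  assumes U: "open U" "z \<in> U" and q: "Ck_on 2 q U"
  shows "((\<lambda>h. (q (z + h *\<^sub>R v + h *\<^sub>R w) - q (z + h *\<^sub>R v) - q (z + h *\<^sub>R w) + q z) / h\<^sup>2)
           \<longlongrightarrow> mixed_derivative q v w z) (at_right 0)"
proof (rule tendstoI)
  fix e :: real assume e: "e > 0"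
  have "isCont (mixed_derivative q v w) z"
    using Ck_on_2D(3)[OF q] U by (simp add: continuous_on_eq_continuous_at)
  then obtain r1 where r1: "r1 > 0"
    "\<And>y. dist y z < r1 \<Longrightarrow> dist (mixed_derivative q v w y) (mixed_derivative q v w z) < e"
    unfolding continuous_at_eps_delta using e by blast
  obtain r2 where r2: "r2 > 0" "ball z r2 \<subseteq> U" using U openE by blast
  define r where "r = min r1 r2"
  have r: "r > 0" using r1 r2 by (simp add: r_def)
  \<comment> \<open>For h < r / M the whole parallelogram lies within r of z; the summand 1 keeps M
    positive.\<close>
  define M where "M = norm v + norm w + 1"
  have M: "M > 0" by (simp add: M_def add_nonneg_pos)
  have near: "dist (z + s *\<^sub>R v + t *\<^sub>R w) z < r" if "0 \<le> s" "s \<le> h" "0 \<le> t" "t \<le> h" "h < r / M" "0 < h" for s t h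
  proof -
    have "dist (z + s *\<^sub>R v + t *\<^sub>R w) z = norm (s *\<^sub>R v + t *\<^sub>R w)" by (simp add: dist_norm add.assoc)
    also have "\<dots> \<le> s * norm v + t * norm w"
      using norm_triangle_ineq[of "s *\<^sub>R v" "t *\<^sub>R w"] that by simp
    also have "\<dots> \<le> h * norm v + h * norm w"
      using that by (intro add_mono mult_right_mono) auto
    also have "\<dots> < h * M" using that by (simp add: M_def algebra_simps)
    also have "\<dots> < r" using that M by (simp add: pos_less_divide_eq)
    finally show ?thesis .
  qed
  have inU: "z + s *\<^sub>R v + t *\<^sub>R w \<in> U" if "0 \<le> s" "s \<le> h" "0 \<le> t" "t \<le> h" "h < r / M" "0 < h" for s t h
    using near[OF that] r2(2) by (auto simp: r_def dist_commute)
  have "\<forall>\<^sub>F h in at_right 0. 0 < h \<and> h < r / M"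
    using r M by (auto simp: eventually_at_right_field intro!: exI[of _ "r / M"])
  then show "\<forall>\<^sub>F h in at_right 0. dist ((q (z + h *\<^sub>R v + h *\<^sub>R w) - q (z + h *\<^sub>R v) - q (z + h *\<^sub>R w) + q z) / h\<^sup>2)
      (mixed_derivative q v w z) < e"
  proof eventually_elim
    case (elim h)
    define \<phi> where "\<phi> s = q (z + h *\<^sub>R w + s *\<^sub>R v) - q (z + s *\<^sub>R v)" for s
    define \<psi> where "\<psi> x = frechet_derivative q (at x) v" for x
    have d\<phi>: "(\<phi> has_real_derivative \<psi> (z + h *\<^sub>R w + s *\<^sub>R v) - \<psi> (z + s *\<^sub>R v)) (at s)"
      if "0 \<le> s" "s \<le> h" for s
      unfolding \<phi>_def [abs_def] \<psi>_def
    proof (intro DERIV_diff directional_derivative Ck_on_2D(1)[OF q])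
      show "z + h *\<^sub>R w + s *\<^sub>R v \<in> U"
        using inU[of s h h] that elim by (simp add: add_ac)
      show "z + s *\<^sub>R v \<in> U"
        using inU[of s h 0] that elim by simp
    qed
    obtain \<xi> where \<xi>: "0 < \<xi>" "\<xi> < h" "\<phi> h - \<phi> 0 = (h - 0) * (\<psi> (z + h *\<^sub>R w + \<xi> *\<^sub>R v) - \<psi> (z + \<xi> *\<^sub>R v))"
      using MVT2[of 0 h \<phi>, OF _ d\<phi>] elim by blast
    have d\<psi>: "((\<lambda>t. \<psi> (z + \<xi> *\<^sub>R v + t *\<^sub>R w)) has_real_derivative mixed_derivative q v w (z + \<xi> *\<^sub>R v + t *\<^sub>R w)) (at t)"
      if "0 \<le> t" "t \<le> h" for t
      unfolding mixed_derivative_def \<psi>_def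
      by (intro directional_derivative Ck_on_2D(2)[OF q] inU[of _ h]) (use that \<xi> elim in auto)
    obtain \<eta> where \<eta>: "0 < \<eta>" "\<eta> < h"
      "\<psi> (z + \<xi> *\<^sub>R v + h *\<^sub>R w) - \<psi> (z + \<xi> *\<^sub>R v + 0 *\<^sub>R w) = (h - 0) * mixed_derivative q v w (z + \<xi> *\<^sub>R v + \<eta> *\<^sub>R w)"
      using MVT2[of 0 h "\<lambda>t. \<psi> (z + \<xi> *\<^sub>R v + t *\<^sub>R w)", OF _ d\<psi>] elim by blast
    have "\<phi> h - \<phi> 0 = h * (h * mixed_derivative q v w (z + \<xi> *\<^sub>R v + \<eta> *\<^sub>R w))"
      using \<xi>(3) \<eta>(3) by (simp add: add_ac)
    moreover have "q (z + h *\<^sub>R v + h *\<^sub>R w) - q (z + h *\<^sub>R v) - q (z + h *\<^sub>R w) + q z = \<phi> h - \<phi> 0"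
      by (simp add: \<phi>_def add_ac)
    ultimately have "(q (z + h *\<^sub>R v + h *\<^sub>R w) - q (z + h *\<^sub>R v) - q (z + h *\<^sub>R w) + q z) / h\<^sup>2
        = mixed_derivative q v w (z + \<xi> *\<^sub>R v + \<eta> *\<^sub>R w)"
      using elim by (simp add: power2_eq_square)
    moreover have "dist (mixed_derivative q v w (z + \<xi> *\<^sub>R v + \<eta> *\<^sub>R w)) (mixed_derivative q v w z) < e"
      using near[of \<xi> h \<eta>] \<xi> \<eta> elim by (intro r1) (simp add: r_def)
    ultimately show ?case by simp
  qed
qed

text \<open>Schwarz's theorem: the parallelogram difference is symmetric in v and w, and limits are
  unique.\<close>

lemma mixed_derivative_symmetric:
  fixes q :: "'a::real_normed_vector \<Rightarrow> real"
  assumes U: "open U" "z \<in> U" and q: "Ck_on 2 q U"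
  shows "mixed_derivative q v w z = mixed_derivative q w v z"
proof -
  have "(q (z + h *\<^sub>R w + h *\<^sub>R v) - q (z + h *\<^sub>R w) - q (z + h *\<^sub>R v) + q z)
      = (q (z + h *\<^sub>R v + h *\<^sub>R w) - q (z + h *\<^sub>R v) - q (z + h *\<^sub>R w) + q z)" for h
    by (simp add: add_ac)
  with mixed_difference_tendsto[OF assms, of w v]
  show ?thesis
    by (intro tendsto_unique[OF _ mixed_difference_tendsto[OF assms, of v w]]) auto
qed

lemma Ck_on_2_second_difference:
  fixes q :: "'a::real_normed_vector \<Rightarrow> real"
  assumes U: "open U" "z \<in> U" and q: "Ck_on 2 q U"
  shows "has_second_difference q b z (mixed_derivative q b b z)"
proof (rule has_second_differenceI)
  have "((\<lambda>t. z + t *\<^sub>R b) \<longlongrightarrow> z) (nhds (0::real))"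
    by (auto intro!: tendsto_eq_intros filterlim_ident)
  then have "\<forall>\<^sub>F t in nhds 0. z + t *\<^sub>R b \<in> U"
    using U topological_tendstoD by blast
  then show "\<forall>\<^sub>F t in nhds 0. ((\<lambda>t. q (z + t *\<^sub>R b)) has_real_derivative frechet_derivative q (at (z + t *\<^sub>R b)) b) (at t)"
    by eventually_elim (intro directional_derivative Ck_on_2D(1)[OF q])
  show "((\<lambda>t. frechet_derivative q (at (z + t *\<^sub>R b)) b) has_real_derivative mixed_derivative q b b z) (at 0)"
    using directional_derivative[of "\<lambda>x. frechet_derivative q (at x) b" z 0 b] Ck_on_2D(2)[OF q U(2)]
    by (simp add: mixed_derivative_def)
qed

text \<open>In this form Hermitian symmetry follows from Schwarz's theorem, and the diagonal entry
  at j is visibly a quarter of the Laplacian in the j-th complex coordinate.\<close>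

lemma complex_hessian_eq:
  fixes q :: "complex ^ 'n::finite \<Rightarrow> real"
  assumes U: "open U" "z \<in> U" and q: "Ck_on 2 q U"
  defines "D \<equiv> \<lambda>v w. mixed_derivative q v w z"
  shows "complex_hessian q z $ j $ k =
    Complex ((D (axis k 1) (axis j 1) + D (axis k \<i>) (axis j \<i>)) / 4)
            ((D (axis k \<i>) (axis j 1) - D (axis k 1) (axis j \<i>)) / 4)"
proof -
  define P where "P v x = frechet_derivative q (at x) v" for v x
  have fd: "frechet_derivative (\<lambda>w. complex_of_real (q w)) (at x) v = complex_of_real (P v x)" if "x \<in> U" for x v
  proof -
    have "(q has_derivative frechet_derivative q (at x)) (at x)"
      using Ck_on_2D(1)[OF q that] by (simp add: frechet_derivative_works)
    then have "((\<lambda>w. complex_of_real (q w)) has_derivative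
        (\<lambda>v. complex_of_real (frechet_derivative q (at x) v))) (at x)"
      by (rule has_derivative_of_real)
    from frechet_derivative_at[OF this, symmetric] show ?thesis
      by (simp add: P_def)
  qed
  define B where "B x = (complex_of_real (P (axis k 1) x) + \<i> * complex_of_real (P (axis k \<i>) x)) / 2" for x
  have B: "dzbar k (\<lambda>w. complex_of_real (q w)) x = B x" if "x \<in> U" for x
    using fd[OF that] by (simp add: dzbar_def B_def)
  have DP: "(P v has_derivative D v) (at z)" for v
    using Ck_on_2D(2)[OF q U(2), of v]
    by (simp add: frechet_derivative_works P_def [abs_def] D_def mixed_derivative_def)
  have "(B has_derivative (\<lambda>w. (complex_of_real (D (axis k 1) w) + \<i> * complex_of_real (D (axis k \<i>) w)) / 2)) (at z)"
    unfolding B_def [abs_def]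
    by (intro bounded_linear.has_derivative[OF bounded_linear_divide]
        has_derivative_add has_derivative_mult_right has_derivative_of_real DP)
  \<comment> \<open>\<open>dzbar\<close> is known to agree with \<open>B\<close> only on U, so the
    derivative is transferred on this open neighbourhood of z.\<close>
  then have "(dzbar k (\<lambda>w. complex_of_real (q w)) has_derivative
      (\<lambda>w. (complex_of_real (D (axis k 1) w) + \<i> * complex_of_real (D (axis k \<i>) w)) / 2)) (at z)"
    by (rule has_derivative_transform_within_open[OF _ U]) (simp add: B)
  then have "frechet_derivative (dzbar k (\<lambda>w. complex_of_real (q w))) (at z)
     = (\<lambda>w. (complex_of_real (D (axis k 1) w) + \<i> * complex_of_real (D (axis k \<i>) w)) / 2)"
    by (rule frechet_derivative_at [symmetric])
  then show ?thesis
    by (simp add: complex_hessian_def dz_def complex_eq_iff)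
qed

lemma sum_Basis_complex_vec:
  "(\<Sum>b\<in>(Basis :: (complex ^ 'n::finite) set). f b) = (\<Sum>j\<in>UNIV. f (axis j 1) + f (axis j \<i>))"
proof -
  have eq: "(Basis :: (complex ^ 'n) set) = (\<lambda>(j, u). axis j u) ` (UNIV \<times> {1, \<i>})"
    by (auto simp: Basis_vec_def Basis_complex_def)
  have inj: "inj_on (\<lambda>(j, u). axis j u :: complex ^ 'n) (UNIV \<times> {1, \<i>})"
    by (auto simp: inj_on_def axis_eq_axis)
  have "(\<Sum>b\<in>(Basis :: (complex ^ 'n) set). f b) = (\<Sum>(j, u)\<in>UNIV \<times> {1, \<i>}. f (axis j u))"
    unfolding eq by (subst sum.reindex[OF inj]) (simp add: case_prod_unfold)
  also have "\<dots> = (\<Sum>j\<in>UNIV. \<Sum>u\<in>{1, \<i>}. f (axis j u))"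
    by (rule sum.cartesian_product [symmetric])
  finally show ?thesis by (simp add: complex_eq_iff)
qed

text \<open>Testing the form on vectors supported in two coordinates gives 2 |H_jk| <= H_jj + H_kk,
  and each diagonal entry is at most the trace because the others are nonnegative.\<close>

lemma hermitian_psd_entry_bound:
  fixes H :: "complex ^ 'n ^ 'n::finite"
  assumes herm: "\<And>j k. H $ k $ j = cnj (H $ j $ k)"
    and psd: "\<And>w :: complex ^ 'n. 0 \<le> Re (\<Sum>j\<in>UNIV. \<Sum>k\<in>UNIV. H $ j $ k * (w $ j) * cnj (w $ k))"
  shows "0 \<le> Re (H $ j $ j)" and "cmod (H $ j $ k) \<le> (\<Sum>i\<in>UNIV. Re (H $ i $ i))"
proof -
  define B where "B v w = (\<Sum>j\<in>UNIV. \<Sum>k\<in>UNIV. H $ j $ k * (v $ j) * cnj (w $ k))" for v w :: "complex ^ 'n"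
  have B_add: "B (v + v') (w + w') = B v w + B v w' + B v' w + B v' w'" for v v' w w'
    by (simp add: B_def sum.distrib [symmetric] algebra_simps)
  have B_axis: "B (axis j a) (axis k b) = H $ j $ k * a * cnj b" for j k a b
  proof -
    have "B (axis j a) (axis k b) = (\<Sum>j'\<in>UNIV. \<Sum>k'\<in>UNIV. if k' = k then (if j' = j then H $ j' $ k' * a * cnj b else 0) else 0)"
      unfolding B_def by (intro sum.cong refl) (auto simp: axis_def)
    then show ?thesis by simp
  qed
  have psd: "0 \<le> Re (B w w)" for w using psd by (simp add: B_def)
  show diag: "0 \<le> Re (H $ j $ j)" for j
    using psd[of "axis j 1"] by (simp add: B_axis)
  have tr: "Re (H $ j $ j) \<le> (\<Sum>i\<in>UNIV. Re (H $ i $ i))" for j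
    using diag by (intro member_le_sum) auto
  show "cmod (H $ j $ k) \<le> (\<Sum>i\<in>UNIV. Re (H $ i $ i))"
  proof (cases "H $ j $ k = 0")
    case True
    then show ?thesis using diag by (simp add: sum_nonneg)
  next
    case False
    \<comment> \<open>The unimodular number that makes both cross terms equal to - |H_jk|.\<close>
    define \<zeta> where "\<zeta> = - H $ j $ k / complex_of_real (cmod (H $ j $ k))"
    have 1: "\<zeta> * cnj \<zeta> = 1"
    proof -
      have "cmod \<zeta> = 1" using False by (simp add: \<zeta>_def norm_divide)
      then show ?thesis using complex_norm_square[of \<zeta>] by simp
    qed
    have 2: "H $ j $ k * cnj \<zeta> = - complex_of_real (cmod (H $ j $ k))"
      using False complex_norm_square[of "H $ j $ k"] by (simp add: \<zeta>_def power2_eq_square field_simps)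
    have 3: "H $ k $ j * \<zeta> = - complex_of_real (cmod (H $ j $ k))"
      using arg_cong[OF 2, of cnj] herm[of k j] by simp
    have "0 \<le> Re (H $ j $ j + H $ j $ k * cnj \<zeta> + H $ k $ j * \<zeta> + H $ k $ k * (\<zeta> * cnj \<zeta>))"
      using psd[of "axis j 1 + axis k \<zeta>"] by (simp add: B_add B_axis mult.assoc)
    then have "2 * cmod (H $ j $ k) \<le> Re (H $ j $ j) + Re (H $ k $ k)"
      unfolding 1 2 3 by simp
    with tr[of j] tr[of k] show ?thesis by linarith
  qed
qed

lemma cmod_det_le:
  fixes A :: "complex ^ 'n ^ 'n::finite"
  assumes "\<And>j k. cmod (A $ j $ k) \<le> M"
  shows "cmod (det A) \<le> fact CARD('n) * M ^ CARD('n)"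
proof -
  have "cmod (det A) \<le> (\<Sum>p\<in>{p. p permutes (UNIV :: 'n set)}. cmod (of_int (sign p) * (\<Prod>i\<in>UNIV. A $ i $ p i)))"
    unfolding det_def by (rule norm_sum)
  also have "\<dots> \<le> (\<Sum>p\<in>{p. p permutes (UNIV :: 'n set)}. M ^ CARD('n))"
  proof (rule sum_mono)
    fix p
    have "cmod (of_int (sign p) * (\<Prod>i\<in>UNIV. A $ i $ p i)) = (\<Prod>i\<in>UNIV. cmod (A $ i $ p i))"
      by (simp add: norm_mult prod_norm [symmetric] sign_def)
    also have "\<dots> \<le> (\<Prod>i\<in>(UNIV :: 'n set). M)"
      using assms by (intro prod_mono) auto
    finally show "cmod (of_int (sign p) * (\<Prod>i\<in>UNIV. A $ i $ p i)) \<le> M ^ CARD('n)" by simp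
  qed
  also have "\<dots> = fact CARD('n) * M ^ CARD('n)"
    by (simp add: card_permutations)
  finally show ?thesis .
qed

text \<open>The trace of the Hessian is \<Delta> / 4 and dominates every entry, so the Leibniz
  expansion bounds the determinant. The factor 4 is given away, since the constant in admissibility
  absorbs such losses.\<close>

lemma monge_ampere_density_le_laplacian:
  fixes q :: "complex ^ 'n::finite \<Rightarrow> real"
  assumes U: "open U" "z \<in> U" and q: "Ck_on 2 q U" and "ddc_nonneg q z"
  defines "\<Delta> \<equiv> \<Sum>b\<in>Basis. mixed_derivative q b b z"
  shows "0 \<le> \<Delta>"
    and "monge_ampere_density q z \<le> 2 ^ CARD('n) * fact CARD('n) * (fact CARD('n) * \<Delta> ^ CARD('n))"
proof -
  define H where "H = complex_hessian q z"
  define t where "t = (\<Sum>i\<in>UNIV. Re (H $ i $ i))"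
  note sym = mixed_derivative_symmetric[OF U q]
  have herm: "H $ k $ j = cnj (H $ j $ k)" for j k
    unfolding H_def complex_hessian_eq[OF U q]
    by (auto simp: sym[of "axis j _" "axis k _"] complex_eq_iff field_simps)
  have psd: "0 \<le> Re (\<Sum>j\<in>UNIV. \<Sum>k\<in>UNIV. H $ j $ k * (w $ j) * cnj (w $ k))" for w
    using \<open>ddc_nonneg q z\<close> by (simp add: ddc_nonneg_def levi_form_def H_def)
  note bound = hermitian_psd_entry_bound[OF herm psd]
  have "\<Delta> = 4 * t"
    unfolding \<Delta>_def t_def H_def complex_hessian_eq[OF U q] sum_Basis_complex_vec
    by (simp add: sum_distrib_left add_divide_distrib)
  moreover have "t \<ge> 0" using bound(1) by (simp add: t_def sum_nonneg)
  ultimately have \<Delta>: "0 \<le> \<Delta>" "t \<le> \<Delta>" by auto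
  then show "0 \<le> \<Delta>" by simp
  have "Re (det H) \<le> cmod (det H)" by (rule complex_Re_le_cmod)
  also have "\<dots> \<le> fact CARD('n) * \<Delta> ^ CARD('n)"
    by (rule cmod_det_le) (rule order_trans[OF bound(2) \<Delta>(2)[unfolded t_def]])
  finally show "monge_ampere_density q z \<le> 2 ^ CARD('n) * fact CARD('n) * (fact CARD('n) * \<Delta> ^ CARD('n))"
    unfolding monge_ampere_density_def H_def [symmetric] by (intro mult_left_mono) auto
qed

section \<open>Volume of sublevel sets of plurisubharmonic functions\<close>

lemma norm_vector_scalar_mult: "norm (c *s (x :: complex ^ 'n::finite)) = cmod c * norm x"
proof -
  have "norm (c *s x) = sqrt (\<Sum>i\<in>UNIV. (cmod c)\<^sup>2 * (norm (x $ i))\<^sup>2)"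
    by (simp add: norm_vec_def L2_set_def norm_mult power_mult_distrib)
  then show ?thesis
    by (simp add: sum_distrib_left [symmetric] real_sqrt_mult norm_vec_def L2_set_def)
qed

section \<open>Invariance of Lebesgue measure under unimodular scalars\<close>

lemma lborel_distr_orthogonal_cart:
  fixes f :: "real ^ 'm::{finite, wellorder} \<Rightarrow> real ^ 'm::_"
  assumes f: "orthogonal_transformation f"
  shows "distr lborel borel f = lborel"
proof (rule lborel_eqI [symmetric])
  fix l u :: "real ^ 'm::_" assume lu: "\<And>b. b \<in> Basis \<Longrightarrow> l \<bullet> b \<le> u \<bullet> b"
  have bij: "bij f" by (rule orthogonal_transformation_bij[OF f])
  have [measurable]: "f \<in> borel_measurable borel"
    using orthogonal_transformation_linear[OF f]
    by (intro borel_measurable_continuous_onI linear_continuous_on) (simp add: linear_linear)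
  have fi: "orthogonal_transformation (inv f)" by (rule orthogonal_transformation_inv[OF f])
  have box: "box l u \<in> lmeasurable" by simp
  have "emeasure (distr lborel borel f) (box l u) = emeasure lborel (f -` box l u)"
    by (subst emeasure_distr) auto
  also have "f -` box l u = inv f ` box l u"
    using bij by (simp add: bij_vimage_eq_inv_image)
  \<comment> \<open>The image is also the preimage of a box under the continuous f, hence Borel, and
    there both measures agree.\<close>
  also have "emeasure lborel (inv f ` box l u) = emeasure lebesgue (inv f ` box l u)"
  proof -
    have "f -` box l u \<in> sets borel" by (rule measurable_sets_borel[OF \<open>f \<in> _\<close>]) simp
    then show ?thesis using bij by (simp add: bij_vimage_eq_inv_image)
  qed
  also have "\<dots> = ennreal (measure lebesgue (inv f ` box l u))"
    by (intro emeasure_eq_measure2 measurable_orthogonal_image[OF fi box])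
  also have "\<dots> = ennreal (measure lebesgue (box l u))"
    by (simp only: measure_orthogonal_image[OF fi box])
  also have "\<dots> = emeasure lebesgue (box l u)"
    by (intro emeasure_eq_measure2[symmetric] box)
  also have "\<dots> = emeasure lborel (box l u)" by simp
  also have "\<dots> = (\<Prod>b\<in>Basis. (u - l) \<bullet> b)"
    using lu by (rule emeasure_lborel_box)
  finally show "emeasure (distr lborel borel f) (box l u) = (\<Prod>b\<in>Basis. (u - l) \<bullet> b)" .
qed simp

text \<open>The library has invariance under orthogonal maps only for \<open>real ^ 'm\<close> with a well-ordered index
  type.\<close>

lemma lborel_distr_orthogonal:
  fixes f :: "'a::euclidean_space \<Rightarrow> 'a" and \<beta> :: "'m::{finite, wellorder} \<Rightarrow> 'a"
  assumes f: "orthogonal_transformation f" and \<beta>: "bij_betw \<beta> UNIV Basis"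
  shows "distr lborel borel f = lborel"
proof -
  \<comment> \<open>T is the coordinate isometry onto \<open>'a\<close>; conjugating f by it
    produces an orthogonal map g of \<open>real ^ 'm\<close>, to which the previous lemma
    applies.\<close>
  define T where "T x = (\<Sum>i\<in>UNIV. (x $ i) *\<^sub>R \<beta> i)" for x :: "real ^ 'm::_"
  define T' where "T' y = (\<chi> i. y \<bullet> \<beta> i)" for y :: 'a
  have \<beta>_Basis: "\<beta> i \<in> Basis" for i using \<beta> by (auto simp: bij_betw_def)
  have \<beta>_inner: "\<beta> i \<bullet> \<beta> j = (if i = j then 1 else 0)" for i j
    using \<beta> \<beta>_Basis[of i] \<beta>_Basis[of j] by (auto simp: inner_Basis bij_betw_def inj_on_def)
  have T_inner: "T x \<bullet> \<beta> i = x $ i" for x i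
    by (simp add: T_def inner_sum_left \<beta>_inner if_distrib cong: if_cong)
  have T'T: "T' (T x) = x" for x by (simp add: T'_def T_inner vec_eq_iff)
  have TT': "T (T' y) = y" for y
    using sum.reindex_bij_betw[OF \<beta>, of "\<lambda>b. (y \<bullet> b) *\<^sub>R b"]
    by (simp add: T_def T'_def euclidean_representation)
  have T'_inner: "T' y \<bullet> T' y' = y \<bullet> y'" for y y'
    using sum.reindex_bij_betw[OF \<beta>, of "\<lambda>b. (y \<bullet> b) * (y' \<bullet> b)"]
    by (simp add: T'_def inner_vec_def euclidean_inner[of y y'])
  have T_inner2: "T x \<bullet> T x' = x \<bullet> x'" for x x'
    using T'_inner[of "T x" "T x'"] by (simp add: T'T)
  have linT: "linear T"
    by (rule linearI) (auto simp: T_def scaleR_add_left sum.distrib scaleR_sum_right)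
  have linT': "linear T'"
    by (rule linearI) (auto simp: T'_def vec_eq_iff inner_add_left)
  have [measurable]: "T \<in> borel_measurable borel" "f \<in> borel_measurable borel"
    using linT orthogonal_transformation_linear[OF f]
    by (auto intro!: borel_measurable_continuous_onI linear_continuous_on simp: linear_linear)
  have T: "distr lborel borel T = lborel"
  proof (rule lborel_eqI [symmetric])
    fix l u :: 'a assume lu: "\<And>b. b \<in> Basis \<Longrightarrow> l \<bullet> b \<le> u \<bullet> b"
    have "(\<forall>b\<in>Basis. P b) \<longleftrightarrow> (\<forall>i. P (\<beta> i))" for P
      using \<beta> by (metis \<beta>_Basis bij_betw_imp_surj_on imageE)
    then have vimage: "T -` box l u = box (T' l) (T' u)"
      by (auto simp: box_def Basis_vec_def T_inner T'_def inner_axis)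
    have BasisV: "(Basis :: (real ^ 'm::_) set) = range (\<lambda>i. axis i 1)"
      by (auto simp: Basis_vec_def)
    have inj: "inj (\<lambda>i::'m. axis i (1::real))"
      by (auto simp: inj_on_def axis_eq_axis)
    have "emeasure (distr lborel borel T) (box l u) = emeasure lborel (box (T' l) (T' u))"
      by (subst emeasure_distr) (auto simp: vimage)
    also have "\<dots> = (\<Prod>b\<in>Basis. (T' u - T' l) \<bullet> b)"
      by (rule emeasure_lborel_box) (use lu \<beta>_Basis in \<open>auto simp: BasisV T'_def inner_axis\<close>)
    also have "(\<Prod>b\<in>Basis. (T' u - T' l) \<bullet> b) = (\<Prod>i\<in>UNIV. (u - l) \<bullet> \<beta> i)"
      unfolding BasisV by (subst prod.reindex[OF inj]) (simp add: T'_def inner_axis inner_diff_left)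
    also have "\<dots> = (\<Prod>b\<in>Basis. (u - l) \<bullet> b)"
      by (rule prod.reindex_bij_betw[OF \<beta>])
    finally show "emeasure (distr lborel borel T) (box l u) = (\<Prod>b\<in>Basis. (u - l) \<bullet> b)" .
  qed simp
  define g where "g = T' \<circ> f \<circ> T"
  have g: "orthogonal_transformation g"
    using f linT linT'
    by (auto simp: g_def orthogonal_transformation_def T'_inner T_inner2 intro!: linear_compose)
  then have [measurable]: "g \<in> borel_measurable borel"
    using orthogonal_transformation_linear[OF g]
    by (intro borel_measurable_continuous_onI linear_continuous_on) (simp add: linear_linear)
  have fT: "f \<circ> T = T \<circ> g" by (auto simp: g_def TT')
  have "distr lborel borel f = distr (distr lborel borel T) borel f" by (simp only: T)
  also have "\<dots> = distr lborel borel (f \<circ> T)" by (rule distr_distr) auto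
  also have "\<dots> = distr (distr lborel borel g) borel T"
    unfolding fT by (rule distr_distr [symmetric]) auto
  also have "\<dots> = lborel" by (simp only: lborel_distr_orthogonal_cart[OF g] T)
  finally show ?thesis .
qed

lemma lborel_distr_rotation:
  assumes c: "cmod c = 1"
  shows "distr lborel borel (\<lambda>b :: complex ^ 'n::finite. c *s b) = lborel"
proof -
  \<comment> \<open>\<open>'n bit0\<close> is a well-ordered type with \<open>2 * CARD('n)\<close>
    elements, which is the real dimension.\<close>
  have "\<exists>\<beta>. bij_betw \<beta> (UNIV :: 'n bit0 set) (Basis :: (complex ^ 'n) set)"
    by (rule finite_same_card_bij) simp_all
  then obtain \<beta> :: "'n bit0 \<Rightarrow> complex ^ 'n" where \<beta>: "bij_betw \<beta> UNIV Basis" by blast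
  have "linear (\<lambda>b :: complex ^ 'n. c *s b)"
    by (rule linearI) (auto simp: vec_eq_iff algebra_simps)
  then have "orthogonal_transformation (\<lambda>b :: complex ^ 'n. c *s b)"
    by (simp add: orthogonal_transformation norm_vector_scalar_mult c)
  then show ?thesis using \<beta> by (rule lborel_distr_orthogonal)
qed

section \<open>From sub-mean values on circles to volumes\<close>

lemma circle_integral_le:
  fixes h :: "real \<Rightarrow> real"
  assumes le: "\<And>\<theta>. \<lbrakk>0 \<le> \<theta>; \<theta> \<le> 2 * pi\<rbrakk> \<Longrightarrow> u (a + cis \<theta> *s b) \<le> ereal (h \<theta>)"
    and h: "integrable lborel (\<lambda>\<theta>. h \<theta> * indicator {0..2 * pi} \<theta>)"
  shows "circle_integral u a b \<le> ereal (LINT \<theta>|lborel. h \<theta> * indicator {0..2 * pi} \<theta>)"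
proof -
  define k where "k \<theta> = h \<theta> * indicator {0..2 * pi} \<theta>" for \<theta> :: real
  have k: "integrable lborel k" using h by (simp add: k_def [abs_def])
  \<comment> \<open>Integrals of the positive and negative parts of the majorant. Both are finite,
    so the comparison never meets a difference of infinities.\<close>
  define P where "P = (\<integral>\<^sup>+\<theta>. ennreal (k \<theta>) \<partial>lborel)"
  define Q where "Q = (\<integral>\<^sup>+\<theta>. ennreal (- k \<theta>) \<partial>lborel)"
  have fin: "P < \<infinity>" "Q < \<infinity>"
    using k by (auto simp: real_integrable_def P_def Q_def less_top)
  have "(\<integral>\<^sup>+\<theta>\<in>{0..2 * pi}. e2ennreal (u (a + cis \<theta> *s b)) \<partial>lborel) \<le> P"
    unfolding P_def
  proof (rule nn_integral_mono)
    fix \<theta> :: real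
    show "e2ennreal (u (a + cis \<theta> *s b)) * indicator {0..2 * pi} \<theta> \<le> ennreal (k \<theta>)"
      using e2ennreal_mono[OF le, of \<theta>] by (auto simp: k_def indicator_def)
  qed
  moreover have "Q \<le> (\<integral>\<^sup>+\<theta>\<in>{0..2 * pi}. e2ennreal (- u (a + cis \<theta> *s b)) \<partial>lborel)"
    unfolding Q_def
  proof (rule nn_integral_mono)
    fix \<theta> :: real
    have "e2ennreal (ereal (- h \<theta>)) \<le> e2ennreal (- u (a + cis \<theta> *s b))" if "0 \<le> \<theta>" "\<theta> \<le> 2 * pi"
      using le[OF that] by (intro e2ennreal_mono) (simp add: ereal_uminus_le_reorder flip: uminus_ereal.simps)
    then show "ennreal (- k \<theta>) \<le> e2ennreal (- u (a + cis \<theta> *s b)) * indicator {0..2 * pi} \<theta>"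
      by (auto simp: k_def indicator_def)
  qed
  ultimately have "circle_integral u a b \<le> enn2ereal P - enn2ereal Q"
    unfolding circle_integral_def by (intro ereal_minus_mono) (simp_all add: less_eq_ennreal.rep_eq [symmetric])
  also have "\<dots> = ereal (enn2real P - enn2real Q)"
    using fin by (cases P; cases Q) auto
  also have "enn2real P - enn2real Q = (LINT \<theta>|lborel. k \<theta>)"
    unfolding P_def Q_def by (rule real_lebesgue_integral_def[OF k, symmetric])
  finally show ?thesis by (simp add: k_def)
qed

lemma usc_on_open_sublevel:
  assumes "open D" "usc_on D u"
  shows "open {z \<in> D. u z < c}"
proof (subst open_subopen, intro ballI)
  fix z assume z: "z \<in> {z \<in> D. u z < c}"
  then have "Limsup (inf (nhds z) (principal D)) u < c"
    using assms(2) by (auto simp: usc_on_def usc_regularization_def intro: le_less_trans)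
  from Limsup_lessD[OF this] have "\<forall>\<^sub>F w in nhds z. w \<in> D \<longrightarrow> u w < c"
    by (simp add: eventually_inf_principal)
  then obtain S where "open S" "z \<in> S" "\<And>w. w \<in> S \<Longrightarrow> w \<in> D \<longrightarrow> u w < c"
    by (auto simp: eventually_nhds)
  then show "\<exists>T. open T \<and> z \<in> T \<and> T \<subseteq> {z \<in> D. u z < c}"
    using z assms(1) by (intro exI[of _ "S \<inter> D"]) auto
qed

text \<open>A reverse Markov inequality: the function is at most M on the circle and below a on a
  set A of angles, so its integral is at most 2 pi M - (M - a) |A|, whereas the sub-mean value
  property makes it at least 2 pi c.\<close>

lemma circle_sublevel_measure:
  fixes u :: "complex ^ 'n::finite \<Rightarrow> ereal"
  assumes sub: "ereal (2 * pi) * u w \<le> circle_integral u w b"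
    and M: "\<And>\<theta>. u (w + cis \<theta> *s b) \<le> ereal M" and c: "ereal c \<le> u w" and a: "a < M"
    and V: "open V" "\<And>z. z \<in> V \<Longrightarrow> u z < ereal a"
  shows "emeasure lborel {\<theta> \<in> {0..2 * pi}. w + cis \<theta> *s b \<in> V} \<le> ennreal (2 * pi * (M - c) / (M - a))"
proof -
  define A where "A = {\<theta> \<in> {0..2 * pi}. w + cis \<theta> *s b \<in> V}"
  have "continuous_on UNIV (\<lambda>\<theta>. w + cis \<theta> *s b)"
    unfolding vector_scalar_mult_def by (intro continuous_intros)
  then have "open ((\<lambda>\<theta>. w + cis \<theta> *s b) -` V)"
    using V(1) by (rule open_vimage[OF _ , rotated])
  moreover have "A = {0..2 * pi} \<inter> (\<lambda>\<theta>. w + cis \<theta> *s b) -` V" by (auto simp: A_def)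
  ultimately have A: "A \<in> sets lborel" by auto
  have "emeasure lborel A \<le> emeasure lborel {0..2 * pi}"
    by (rule emeasure_mono) (auto simp: A_def)
  then have A_fin: "emeasure lborel A < \<infinity>" using pi_ge_zero by (simp add: le_less_trans)
  define h where "h \<theta> = M - (M - a) * indicator A \<theta>" for \<theta> :: real
  have eq: "h \<theta> * indicator {0..2 * pi} \<theta> = M * indicator {0..2 * pi} \<theta> - (M - a) * indicator A \<theta>" for \<theta>
    by (auto simp: h_def A_def indicator_def)
  have int: "integrable lborel (\<lambda>\<theta>. h \<theta> * indicator {0..2 * pi} \<theta>)"
    unfolding eq using A A_fin by (intro Bochner_Integration.integrable_diff integrable_mult_right) auto
  have "(LINT \<theta>|lborel. h \<theta> * indicator {0..2 * pi} \<theta>) = M * (2 * pi) - (M - a) * measure lborel A"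
    unfolding eq using A A_fin pi_ge_zero
    by (subst Bochner_Integration.integral_diff) auto
  moreover have "circle_integral u w b \<le> ereal (LINT \<theta>|lborel. h \<theta> * indicator {0..2 * pi} \<theta>)"
  proof (rule circle_integral_le[OF _ int])
    fix \<theta> :: real
    show "u (w + cis \<theta> *s b) \<le> ereal (h \<theta>)"
      using M[of \<theta>] V(2)[of "w + cis \<theta> *s b"] by (auto simp: h_def A_def indicator_def)
  qed
  moreover have "ereal (2 * pi * c) \<le> ereal (2 * pi) * u w"
    using ereal_mult_left_mono[OF c, of "ereal (2 * pi)"] by simp
  ultimately have "ereal (2 * pi * c) \<le> ereal (M * (2 * pi) - (M - a) * measure lborel A)"
    using sub by (metis order_trans)
  then have "measure lborel A \<le> 2 * pi * (M - c) / (M - a)"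
    using a by (simp add: field_simps)
  then show ?thesis
    unfolding A_def [symmetric] using A_fin by (simp add: emeasure_eq_ennreal_measure less_top ennreal_leI)
qed

text \<open>The circle estimate is integrated over all b in the ball of radius r about 0. Rotation
  invariance makes every angle contribute the same volume, so exchanging the integrals passes from
  circles to the ball without polar coordinates.\<close>

lemma plurisubharmonic_sublevel_measure:
  fixes u :: "complex ^ 'n::finite \<Rightarrow> ereal"
  assumes psh: "plurisubharmonic_on D u" and D: "open D" "cball w r \<subseteq> D" and r: "r > 0"
    and M: "\<And>z. z \<in> cball w r \<Longrightarrow> u z \<le> ereal M" and c: "ereal c \<le> u w" and a: "a < M"
  shows "{z \<in> ball w r. u z < ereal a} \<in> lmeasurable"
    and "measure lebesgue {z \<in> ball w r. u z < ereal a} \<le> (M - c) / (M - a) * measure lebesgue (ball w r)"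
proof -
  define V where "V = {z \<in> ball w r. u z < ereal a}"
  have "V = ball w r \<inter> {z \<in> D. u z < ereal a}"
    using D(2) by (auto simp: V_def)
  then have V: "open V"
    using usc_on_open_sublevel[OF D(1), of u] psh by (auto simp: plurisubharmonic_on_def)
  have V_meas: "V \<in> lmeasurable"
    by (rule lmeasurable_open) (use V in \<open>auto simp: V_def intro: bounded_subset[OF bounded_ball[of w r]]\<close>)
  then show "{z \<in> ball w r. u z < ereal a} \<in> lmeasurable" by (simp add: V_def)
  define \<kappa> where "\<kappa> = (M - c) / (M - a)"
  have cM: "c \<le> M" using c M[of w] r by (metis centre_in_cball ereal_less_eq(3) less_imp_le order_trans)
  have \<kappa>: "\<kappa> \<ge> 0" using cM a by (simp add: \<kappa>_def)
  define F :: "complex ^ 'n \<Rightarrow> real \<Rightarrow> ennreal" where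
    "F b \<theta> = indicator (ball 0 r) b * (indicator {0..2 * pi} \<theta> * indicator V (w + cis \<theta> *s b))" for b \<theta>
  have cont: "continuous_on UNIV (\<lambda>p :: (complex ^ 'n) \<times> real. w + cis (snd p) *s fst p)"
    unfolding vector_scalar_mult_def by (intro continuous_intros)
  have F_meas: "case_prod F \<in> borel_measurable (lborel \<Otimes>\<^sub>M lborel)"
  proof -
    have 1: "(\<lambda>p :: (complex ^ 'n) \<times> real. w + cis (snd p) *s fst p) \<in> borel \<rightarrow>\<^sub>M borel"
      by (rule borel_measurable_continuous_onI[OF cont])
    have [measurable]: "(\<lambda>p :: (complex ^ 'n) \<times> real. w + cis (snd p) *s fst p) \<in> borel \<Otimes>\<^sub>M borel \<rightarrow>\<^sub>M borel"
      using 1 by (simp add: borel_prod)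
    have [measurable]: "V \<in> sets borel" using V by simp
    have "(\<lambda>p :: (complex ^ 'n) \<times> real. indicator V (w + cis (snd p) *s fst p) :: ennreal) \<in> borel_measurable (borel \<Otimes>\<^sub>M borel)"
      by (rule measurable_compose[OF _ borel_measurable_indicator]) measurable
    moreover have "(\<lambda>p :: (complex ^ 'n) \<times> real. indicator (ball 0 r) (fst p) :: ennreal) \<in> borel_measurable (borel \<Otimes>\<^sub>M borel)"
      by (rule measurable_compose[OF measurable_fst borel_measurable_indicator]) simp
    moreover have "(\<lambda>p :: (complex ^ 'n) \<times> real. indicator {0..2 * pi} (snd p) :: ennreal) \<in> borel_measurable (borel \<Otimes>\<^sub>M borel)"
      by (rule measurable_compose[OF measurable_snd borel_measurable_indicator]) simp
    ultimately have "(\<lambda>p. F (fst p) (snd p)) \<in> borel_measurable (borel \<Otimes>\<^sub>M borel)"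
      unfolding F_def by (intro borel_measurable_times_ennreal)
    then show ?thesis by (simp add: case_prod_unfold cong: measurable_cong_sets sets_pair_measure_cong)
  qed
  \<comment> \<open>For fixed b: the measure of the angles at which the circle through w + b meets
    V.\<close>
  have inner1: "(\<integral>\<^sup>+\<theta>. F b \<theta> \<partial>lborel) \<le> ennreal (2 * pi * \<kappa>) * indicator (ball 0 r) b" for b
  proof (cases "b \<in> ball 0 r")
    case False
    then show ?thesis by (simp add: F_def)
  next
    case True
    then have b: "norm b < r" by simp
    have disc: "w + \<zeta> *s b \<in> cball w r" if "norm \<zeta> \<le> 1" for \<zeta>
    proof -
      have "norm \<zeta> * norm b \<le> 1 * norm b" using that by (intro mult_right_mono) auto
      with b show ?thesis by (simp add: dist_norm norm_vector_scalar_mult)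
    qed
    have "(\<integral>\<^sup>+\<theta>. F b \<theta> \<partial>lborel) = (\<integral>\<^sup>+\<theta>. indicator {\<theta> \<in> {0..2 * pi}. w + cis \<theta> *s b \<in> V} \<theta> \<partial>lborel)"
      using True by (intro nn_integral_cong) (auto simp: F_def indicator_def)
    also have "\<dots> = emeasure lborel {\<theta> \<in> {0..2 * pi}. w + cis \<theta> *s b \<in> V}"
    proof (rule nn_integral_indicator)
      have "continuous_on UNIV (\<lambda>\<theta>. w + cis \<theta> *s b)"
        unfolding vector_scalar_mult_def by (intro continuous_intros)
      then have "open ((\<lambda>\<theta>. w + cis \<theta> *s b) -` V)"
        using V by (rule open_vimage[OF _ , rotated])
      moreover have "{\<theta> \<in> {0..2 * pi}. w + cis \<theta> *s b \<in> V} = {0..2 * pi} \<inter> (\<lambda>\<theta>. w + cis \<theta> *s b) -` V" by auto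
      ultimately show "{\<theta> \<in> {0..2 * pi}. w + cis \<theta> *s b \<in> V} \<in> sets lborel" by auto
    qed
    also have "\<dots> \<le> ennreal (2 * pi * (M - c) / (M - a))"
    proof (rule circle_sublevel_measure[where u = u, OF _ _ c a V])
      show "ereal (2 * pi) * u w \<le> circle_integral u w b"
        using psh disc D(2) unfolding plurisubharmonic_on_def by blast
      show "u (w + cis \<theta> *s b) \<le> ereal M" for \<theta> by (intro M disc) simp
      show "u z < ereal a" if "z \<in> V" for z using that by (simp add: V_def)
    qed
    finally show ?thesis using True by (simp add: \<kappa>_def)
  qed
  \<comment> \<open>For fixed angle: V lies in \<open>ball w r\<close>, so the cutoff in b is
    automatic, and a rotation followed by a translation carries the slice to V.\<close>
  have inner2: "(\<integral>\<^sup>+b. F b \<theta> \<partial>lborel) = indicator {0..2 * pi} \<theta> * emeasure lborel V" for \<theta>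
  proof -
    have [measurable]: "V \<in> sets borel" using V by simp
    have rot: "distr lborel borel (\<lambda>b :: complex ^ 'n. cis \<theta> *s b) = lborel"
      by (rule lborel_distr_rotation) simp
    have [measurable]: "(\<lambda>b :: complex ^ 'n. cis \<theta> *s b) \<in> borel_measurable borel"
      unfolding vector_scalar_mult_def by (intro borel_measurable_continuous_onI continuous_intros)
    have "(\<integral>\<^sup>+b. F b \<theta> \<partial>lborel) = (\<integral>\<^sup>+b. indicator {0..2 * pi} \<theta> * indicator V (w + cis \<theta> *s b) \<partial>lborel)"
    proof (intro nn_integral_cong)
      fix b
      have "b \<in> ball 0 r" if "w + cis \<theta> *s b \<in> V"
        using that by (simp add: V_def dist_norm norm_vector_scalar_mult)
      then show "F b \<theta> = indicator {0..2 * pi} \<theta> * indicator V (w + cis \<theta> *s b)"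
        by (auto simp: F_def indicator_def)
    qed
    also have "\<dots> = indicator {0..2 * pi} \<theta> * (\<integral>\<^sup>+b. indicator V (w + cis \<theta> *s b) \<partial>lborel)"
      by (rule nn_integral_cmult) measurable
    also have "(\<integral>\<^sup>+b. indicator V (w + cis \<theta> *s b) \<partial>lborel)
        = (\<integral>\<^sup>+b. indicator V (w + b) \<partial>distr lborel borel (\<lambda>b. cis \<theta> *s b))"
      by (rule nn_integral_distr [symmetric]) auto
    also have "\<dots> = (\<integral>\<^sup>+b. indicator V (w + b) \<partial>lborel)" by (simp only: rot)
    also have "\<dots> = (\<integral>\<^sup>+b. indicator V b \<partial>distr lborel borel ((+) w))"
      by (rule nn_integral_distr [symmetric]) auto
    also have "\<dots> = emeasure lborel V" by (simp add: lborel_distr_plus)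
    finally show ?thesis .
  qed
  have "ennreal (2 * pi) * emeasure lborel V = (\<integral>\<^sup>+\<theta>. indicator {0..2 * pi} \<theta> * emeasure lborel V \<partial>lborel)"
    by (subst nn_integral_multc) (auto simp: pi_ge_zero)
  also have "\<dots> = (\<integral>\<^sup>+\<theta>. \<integral>\<^sup>+b. F b \<theta> \<partial>lborel \<partial>lborel)" by (simp add: inner2)
  also have "\<dots> = (\<integral>\<^sup>+b. \<integral>\<^sup>+\<theta>. F b \<theta> \<partial>lborel \<partial>lborel)"
    by (rule lborel_pair.Fubini'[OF F_meas])
  also have "\<dots> \<le> (\<integral>\<^sup>+b. ennreal (2 * pi * \<kappa>) * indicator (ball (0 :: complex ^ 'n) r) b \<partial>lborel)"
    by (intro nn_integral_mono inner1)
  also have "\<dots> = ennreal (2 * pi * \<kappa>) * emeasure lborel (ball (0 :: complex ^ 'n) r)"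
    by (rule nn_integral_cmult_indicator) simp
  finally have *: "ennreal (2 * pi) * emeasure lborel V \<le> ennreal (2 * pi * \<kappa>) * emeasure lborel (ball (0 :: complex ^ 'n) r)" .
  have "emeasure lborel V = ennreal (measure lebesgue V)"
    using emeasure_eq_measure2[OF V_meas] V by simp
  moreover have "emeasure lborel (ball (0 :: complex ^ 'n) r) = ennreal (measure lebesgue (ball w r))"
    using emeasure_eq_measure2[OF lmeasurable_ball[of w r]] r
    by (simp add: emeasure_ball[of r "0 :: complex ^ 'n"] emeasure_ball[of r w])
  ultimately have "ennreal (2 * pi * measure lebesgue V) \<le> ennreal (2 * pi * \<kappa> * measure lebesgue (ball w r))"
    using * \<kappa> by (simp add: ennreal_mult)
  then have "2 * pi * measure lebesgue V \<le> 2 * pi * \<kappa> * measure lebesgue (ball w r)"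
    using \<kappa> by (subst (asm) ennreal_le_iff) auto
  then show "measure lebesgue {z \<in> ball w r. u z < ereal a} \<le> (M - c) / (M - a) * measure lebesgue (ball w r)"
    unfolding V_def [symmetric] \<kappa>_def [symmetric] by simp
qed

section \<open>Null sets\<close>

text \<open>Near x the supremum S stays below s + \<delta>, where s is its regularization at x,
  while a single member u of the family exceeds s - \<delta> at a point w close to x. Such a u
  cannot be below a < s on a large part of a ball about w. Working with one u gives an open set
  covering A near x, so the possible non-measurability of S is harmless.\<close>

lemma negligible_in_imp_negligible:
  fixes D :: "(complex ^ 'n::finite) set"
  assumes "open D" "negligible_in D N"
  shows "negligible N"
proof -
  obtain F where F: "\<And>u. u \<in> F \<Longrightarrow> plurisubharmonic_on D u"
    and bdd: "locally_uniformly_bounded_above_on D F"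
    and N: "N \<subseteq> {z\<in>D. (SUP u\<in>F. u z) < usc_regularization D (\<lambda>w. SUP u\<in>F. u w) z}"
    using assms(2) unfolding negligible_in_def by blast
  define S where "S z = (SUP u\<in>F. u z)" for z
  define S' where "S' = usc_regularization D S"
  define A where "A a = {z \<in> D. S z < ereal a \<and> ereal a < S' z}" for a
  have near: "\<forall>\<^sub>F w in nhds z. w \<in> D \<longrightarrow> S w < c" if "S' z < c" for z c
    using Limsup_lessD[OF that[unfolded S'_def usc_regularization_def]]
    by (simp add: eventually_inf_principal)
  have below: "S' z \<le> c" if "\<forall>\<^sub>F w in nhds z. w \<in> D \<longrightarrow> S w \<le> c" for z c
    unfolding S'_def usc_regularization_def
    using that by (intro Limsup_bounded) (simp add: eventually_inf_principal)
  have "negligible (A a)" for a :: real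
    unfolding negligible_eq_zero_density
  proof (intro ballI allI impI)
    fix x r0 e :: _ assume x: "x \<in> A a" and r0: "r0 > (0::real)" and e: "e > (0::real)"
    have xD: "x \<in> D" using x by (simp add: A_def)
    obtain V M0 where V: "open V" "x \<in> V" "\<And>u w. \<lbrakk>u \<in> F; w \<in> V \<inter> D\<rbrakk> \<Longrightarrow> u w \<le> ereal M0"
      proof -
      from bdd xD obtain V M0 where "open V" "x \<in> V" "\<forall>u\<in>F. \<forall>w\<in>V \<inter> D. u w \<le> ereal M0"
        unfolding locally_uniformly_bounded_above_on_def by blast
      then show thesis by (intro that[of V M0]) auto
    qed
    have "\<forall>\<^sub>F w in nhds x. w \<in> V" using V(1,2) by (simp add: eventually_nhds_in_open)
    then have "\<forall>\<^sub>F w in nhds x. w \<in> D \<longrightarrow> S w \<le> ereal M0"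
      by eventually_elim (use V(3) in \<open>simp add: S_def SUP_le_iff\<close>)
    then have "S' x \<le> ereal M0" by (rule below)
    moreover have aS: "ereal a < S' x" using x by (simp add: A_def)
    ultimately obtain s where s: "S' x = ereal s" "a < s"
      by (cases "S' x") auto
    \<comment> \<open>The volume ratio of balls with radii 2 d and d in real dimension
      \<open>2 * CARD('n)\<close>.\<close>
    define K where "K = (2::real) ^ (2 * CARD('n))"
    have K: "K > 0" by (simp add: K_def)
    \<comment> \<open>Makes \<open>2 * \<delta> * K / (s - a)\<close>, which bounds the relative
      volume of W in \<open>ball x d\<close>, smaller than e.\<close>
    define \<delta> where "\<delta> = min ((s - a) / 2) (e * (s - a) / (4 * K))"
    have \<delta>: "\<delta> > 0" "\<delta> < s - a" "2 * \<delta> * K < e * (s - a)"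
    proof -
      have pos: "e * (s - a) / (4 * K) > 0" using s e K by simp
      then show "\<delta> > 0" "\<delta> < s - a" using s by (auto simp: \<delta>_def min_less_iff_disj)
      have "2 * \<delta> * K \<le> 2 * (e * (s - a) / (4 * K)) * K"
        using K by (intro mult_right_mono mult_left_mono) (auto simp: \<delta>_def)
      also have "\<dots> = e * (s - a) / 2" using K by simp
      also have "\<dots> < e * (s - a)" using e s by simp
      finally show "2 * \<delta> * K < e * (s - a)" .
    qed
    define M c where "M = s + \<delta>" and "c = s - \<delta>"
    have "\<forall>\<^sub>F w in nhds x. w \<in> D \<longrightarrow> S w < ereal M"
      using \<delta> s by (intro near) (simp add: M_def)
    moreover have "\<forall>\<^sub>F w in nhds x. w \<in> D" using assms(1) xD by (simp add: eventually_nhds_in_open)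
    ultimately have "\<forall>\<^sub>F w in nhds x. w \<in> D \<and> S w < ereal M" by eventually_elim auto
    then obtain \<rho> where \<rho>: "\<rho> > 0" "\<And>w. dist w x < \<rho> \<Longrightarrow> w \<in> D \<and> S w < ereal M"
      by (auto simp: eventually_nhds_metric)
    \<comment> \<open>The closed ball of radius 2 d about a point within d of x stays within 3 d <
      \<rho> of x, where S is below M.\<close>
    define d where "d = min r0 (\<rho> / 4)"
    have d: "d > 0" "d \<le> r0" "3 * d < \<rho>" using r0 \<rho> by (auto simp: d_def)
    \<comment> \<open>Otherwise S would be at most c near x, and so would its regularization, whose
      value s exceeds c.\<close>
    obtain w where w: "w \<in> D" "dist w x < d" "ereal c < S w"
    proof (rule ccontr)
      assume "\<not> thesis"
      then have "S w \<le> ereal c" if "w \<in> D" "dist w x < d" for w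
        using that \<open>\<And>w. \<lbrakk>w \<in> D; dist w x < d; ereal c < S w\<rbrakk> \<Longrightarrow> thesis\<close> by (meson not_less)
      then have "\<forall>\<^sub>F w in nhds x. w \<in> D \<longrightarrow> S w \<le> ereal c"
        using d(1) by (auto simp: eventually_nhds_metric)
      from below[OF this] show False using s \<delta> by (simp add: c_def)
    qed
    then obtain u where u: "u \<in> F" "ereal c < u w" by (auto simp: S_def less_SUP_iff)
    have le_S: "u z \<le> S z" for z using u(1) by (auto simp: S_def intro: SUP_upper)
    have sub: "dist z x < \<rho>" if "z \<in> cball w (2 * d)" for z
      using that w(2) d dist_triangle[of z x w] by (simp add: dist_commute)
    define W where "W = {z \<in> ball w (2 * d). u z < ereal a}"
    have cball_D: "cball w (2 * d) \<subseteq> D" using sub \<rho>(2) by blast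
    have M: "u z \<le> ereal M" if "z \<in> cball w (2 * d)" for z
      using le_S[of z] \<rho>(2)[OF sub[OF that]] by (meson less_imp_le order_trans)
    have d2: "2 * d > 0" using d(1) by simp
    have aM: "a < M" using \<delta>(1) s(2) by (simp add: M_def)
    have W: "W \<in> lmeasurable" "measure lebesgue W \<le> (M - c) / (M - a) * measure lebesgue (ball w (2 * d))"
      unfolding W_def
      using plurisubharmonic_sublevel_measure[OF F[OF u(1)] assms(1) cball_D d2 M less_imp_le[OF u(2)] aM]
      by blast+
    have "A a \<inter> ball x d \<subseteq> W"
    proof
      fix z assume z: "z \<in> A a \<inter> ball x d"
      then have "dist w z < 2 * d" using w(2) dist_triangle[of w z x] by simp
      moreover have "u z < ereal a" using z le_S[of z] by (auto simp: A_def)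
      ultimately show "z \<in> W" by (simp add: W_def)
    qed
    moreover have "measure lebesgue W < e * measure lebesgue (ball x d)"
    proof -
      define \<omega> where "\<omega> = measure lebesgue (ball x d)"
      have \<omega>: "\<omega> > 0" using content_ball_pos[OF d(1), of x] by (simp add: \<omega>_def)
      have "measure lebesgue (ball w (2 * d)) = K * \<omega>"
        using d(1) content_ball_conv_unit_ball[of "2 * d" w] content_ball_conv_unit_ball[of d x]
        by (simp add: \<omega>_def K_def power_mult_distrib)
      then have "measure lebesgue W \<le> (2 * \<delta> * K / (s + \<delta> - a)) * \<omega>"
        using W(2) by (simp add: M_def c_def mult_ac)
      also have "\<dots> < e * \<omega>"
      proof (intro mult_strict_right_mono \<omega>)
        have "e * (s - a) \<le> e * (s + \<delta> - a)" using e \<delta>(1) by (intro mult_left_mono) auto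
        with \<delta> have "2 * \<delta> * K < e * (s + \<delta> - a)" by linarith
        then show "2 * \<delta> * K / (s + \<delta> - a) < e" using s(2) \<delta>(1) by (simp add: pos_divide_less_eq)
      qed
      finally show ?thesis by (simp add: \<omega>_def)
    qed
    ultimately show "\<exists>d>0. d \<le> r0 \<and> (\<exists>U. A a \<inter> ball x d \<subseteq> U \<and> U \<in> lmeasurable \<and>
        measure lebesgue U < e * measure lebesgue (ball x d))"
      using d W(1) by blast
  qed
  \<comment> \<open>Rational levels suffice to separate S from its regularization, which leaves a
    countable union.\<close>
  then have "negligible (\<Union>a\<in>\<rat>. A a)"
    by (intro negligible_countable_Union) (auto intro: countable_rat)
  moreover have "N \<subseteq> (\<Union>a\<in>\<rat>. A a)"
  proof
    fix z assume "z \<in> N"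
    then have z: "z \<in> D" "S z < S' z" using N by (auto simp: S_def [abs_def] S'_def)
    from ereal_dense3[OF z(2)] obtain a :: rat where "S z < ereal (of_rat a)" "ereal (of_rat a) < S' z"
      by blast
    with z(1) have "z \<in> A (of_rat a)" by (simp add: A_def)
    then show "z \<in> (\<Union>a\<in>\<rat>. A a)" using Rats_of_rat by blast
  qed
  ultimately show ?thesis by (rule negligible_subset)
qed

text \<open>Along a direction transversal to the zero set, small translates of it are disjoint.\<close>

lemma negligible_regular_zero_set:
  fixes \<rho> :: "'a::euclidean_space \<Rightarrow> real"
  assumes U: "open U" and S: "S \<subseteq> U" "closed S" "\<And>x. x \<in> S \<Longrightarrow> \<rho> x = 0"
    and C1: "Ck_on 1 \<rho> U" and reg: "\<And>x. x \<in> S \<Longrightarrow> frechet_derivative \<rho> (at x) \<noteq> (\<lambda>_. 0)"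
  shows "negligible S"
proof (subst locally_negligible_alt, rule ballI)
  fix p assume p: "p \<in> S"
  obtain b where b: "frechet_derivative \<rho> (at p) b \<noteq> 0" using reg[OF p] by (auto simp: fun_eq_iff)
  define D where "D x = frechet_derivative \<rho> (at x) b" for x
  have diff: "\<rho> differentiable (at x)" if "x \<in> U" for x using C1 that by simp
  have "continuous_on U D" using C1 by (simp add: D_def [abs_def])
  then have "isCont D p" using U p S(1) by (auto simp: continuous_on_eq_continuous_at)
  then have "\<forall>\<^sub>F x in nhds p. D x \<noteq> 0"
    using b tendsto_imp_eventually_ne[of D "D p" "at p" 0]
    by (auto simp: isCont_def D_def eventually_nhds_conv_at)
  moreover have "\<forall>\<^sub>F x in nhds p. x \<in> U" using U p S(1) by (auto simp: eventually_nhds_in_open)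
  ultimately have "\<forall>\<^sub>F x in nhds p. x \<in> U \<and> D x \<noteq> 0" by eventually_elim auto
  then obtain r where r: "r > 0" "\<And>x. dist x p < r \<Longrightarrow> x \<in> U \<and> D x \<noteq> 0"
    by (auto simp: eventually_nhds_metric)
  define B where "B = S \<inter> ball p r"
  \<comment> \<open>Between two zeros of \<rho> on a segment in direction b, the mean value theorem
    would give a zero of D inside the ball. Scaling the segment to [0, 1] treats both signs of t at
    once.\<close>
  have unique: "t = 0" if x: "x \<in> B" "x + t *\<^sub>R b \<in> B" for x t
  proof (rule ccontr)
    assume "t \<noteq> 0"
    define f where "f \<tau> = \<rho> (x + (\<tau> * t) *\<^sub>R b)" for \<tau>
    have mem: "x + (\<tau> * t) *\<^sub>R b \<in> ball p r" if "0 \<le> \<tau>" "\<tau> \<le> 1" for \<tau>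
    proof -
      have "(1 - \<tau>) *\<^sub>R x + \<tau> *\<^sub>R (x + t *\<^sub>R b) \<in> ball p r"
        using x that by (intro convexD[OF convex_ball]) (auto simp: B_def)
      then show ?thesis by (simp add: algebra_simps)
    qed
    have der: "(f has_real_derivative D (x + (\<tau> * t) *\<^sub>R b) * t) (at \<tau>)" if "0 \<le> \<tau>" "\<tau> \<le> 1" for \<tau>
    proof -
      have "((\<lambda>s. \<rho> (x + s *\<^sub>R b)) has_real_derivative D (x + (\<tau> * t) *\<^sub>R b)) (at (\<tau> * t))"
        unfolding D_def using mem[OF that] r(2)
        by (intro directional_derivative diff) (simp add: dist_commute)
      moreover have "((\<lambda>\<tau>. \<tau> * t) has_real_derivative t) (at \<tau>)"
        by (auto intro!: derivative_eq_intros)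
      ultimately show ?thesis
        unfolding f_def [abs_def]
        by (rule DERIV_chain2[where f = "\<lambda>s. \<rho> (x + s *\<^sub>R b)" and g = "\<lambda>\<tau>. \<tau> * t"])
    qed
    obtain \<tau> where \<tau>: "0 < \<tau>" "\<tau> < 1" "f 1 - f 0 = (1 - 0) * (D (x + (\<tau> * t) *\<^sub>R b) * t)"
      using MVT2[of 0 1 f, OF _ der] by auto
    have "f 1 = 0" "f 0 = 0" using x S(3) by (auto simp: f_def B_def)
    moreover have "D (x + (\<tau> * t) *\<^sub>R b) \<noteq> 0"
      using mem[of \<tau>] \<tau> r(2) by (simp add: dist_commute)
    ultimately show False using \<tau>(3) \<open>t \<noteq> 0\<close> by simp
  qed
  have B: "B \<in> lmeasurable"
    unfolding B_def using S(2)
    by (intro bounded_set_imp_lmeasurable bounded_Int) (auto intro!: sets_completionI_sets)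
  have "measure lebesgue B = 0"
  proof (rule ccontr)
    assume "measure lebesgue B \<noteq> 0"
    then have pos: "measure lebesgue B > 0" by (simp add: zero_less_measure_iff)
    \<comment> \<open>Infinitely many translates, pairwise disjoint by \<open>unique\<close>, of
      equal measure and all inside the bounded set Z: positive measure is impossible.\<close>
    define T where "T k = (+) ((1 / real (Suc k)) *\<^sub>R b) ` B" for k
    define Z where "Z = ball p (r + norm b)"
    have T: "T k \<in> lmeasurable" "measure lebesgue (T k) = measure lebesgue B" for k
      using B by (simp_all add: T_def measurable_translation measure_translation)
    have TZ: "T k \<subseteq> Z" for k
    proof
      fix y assume "y \<in> T k"
      then obtain x where x: "x \<in> B" "y = (1 / real (Suc k)) *\<^sub>R b + x" by (auto simp: T_def)
      have "dist p y \<le> dist p x + norm ((1 / real (Suc k)) *\<^sub>R b)"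
        unfolding x(2) dist_norm using norm_triangle_ineq4[of "p - x" "(1 / real (Suc k)) *\<^sub>R b"]
        by (simp add: algebra_simps)
      also have "\<dots> < r + norm b"
      proof (intro add_less_le_mono)
        show "dist p x < r" using x(1) by (simp add: B_def)
        have "1 / real (Suc k) * norm b \<le> norm b" by (rule mult_left_le_one_le) auto
        then show "norm ((1 / real (Suc k)) *\<^sub>R b) \<le> norm b" by simp
      qed
      finally show "y \<in> Z" by (simp add: Z_def)
    qed
    have disj: "disjoint_family T"
      unfolding disjoint_family_on_def
    proof (intro ballI impI)
      fix i j :: nat assume "i \<noteq> j"
      show "T i \<inter> T j = {}"
      proof (rule ccontr)
        assume "T i \<inter> T j \<noteq> {}"
        then obtain x y where xy: "x \<in> B" "y \<in> B"
          "(1 / real (Suc i)) *\<^sub>R b + x = (1 / real (Suc j)) *\<^sub>R b + y"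
          by (auto simp: T_def)
        from xy(3) have "y = x + (1 / real (Suc i) - 1 / real (Suc j)) *\<^sub>R b"
          by (simp add: algebra_simps)
        with unique[OF xy(1)] xy(2) have "1 / real (Suc i) - 1 / real (Suc j) = 0" by blast
        with \<open>i \<noteq> j\<close> show False by simp
      qed
    qed
    have "real n * measure lebesgue B \<le> measure lebesgue Z" for n
    proof -
      have "real n * measure lebesgue B = (\<Sum>k<n. measure lebesgue (T k))" by (simp add: T)
      also have "\<dots> = measure lebesgue (\<Union>k<n. T k)"
        by (rule measure_finite_Union [symmetric])
          (use T disj fmeasurableD2[OF T(1)] in \<open>auto simp: disjoint_family_on_def fmeasurableD\<close>)
      also have "\<dots> \<le> measure lebesgue Z"
        using T(1) TZ by (intro measure_mono_fmeasurable) (auto simp: Z_def)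
      finally show ?thesis .
    qed
    moreover obtain n where "real n * measure lebesgue B > measure lebesgue Z"
      using reals_Archimedean3[OF pos] by blast
    ultimately show False by (meson not_less)
  qed
  then have "negligible B" using B by (simp add: negligible_iff_measure)
  moreover have "openin (top_of_set S) B" unfolding B_def by (simp add: openin_open_Int)
  ultimately show "\<exists>V. openin (top_of_set S) V \<and> p \<in> V \<and> negligible V"
    using p r(1) by (intro exI[of _ B]) (auto simp: B_def)
qed

text \<open>The defining function is only known to be negative exactly on \<Omega> near the
  frontier. It vanishes on the frontier because frontier points lie outside the open \<Omega>, while
  a positive value would persist at nearby points of \<Omega>.\<close>

lemma negligible_frontier_smooth_domain:
  fixes \<Omega> :: "(complex ^ 'n::finite) set"
  assumes "smooth_bounded_strongly_pseudoconvex_domain \<Omega>"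
  shows "negligible (frontier \<Omega>)"
proof -
  obtain \<rho> U where U: "open \<Omega>" "open U" "frontier \<Omega> \<subseteq> U" "\<forall>k. Ck_on k \<rho> U"
    "\<Omega> \<inter> U = {z\<in>U. \<rho> z < (0::real)}"
    and "\<forall>p\<in>frontier \<Omega>. frechet_derivative \<rho> (at p) \<noteq> (\<lambda>_. 0) \<and>
           (\<forall>w. w \<noteq> 0 \<and> (\<Sum>j\<in>UNIV. dz j (\<lambda>z. complex_of_real (\<rho> z)) p * (w $ j)) = 0
              \<longrightarrow> levi_form \<rho> p w > 0)"
    using assms unfolding smooth_bounded_strongly_pseudoconvex_domain_def
    by (elim conjE exE) (rule that, assumption+)
  then have reg: "\<And>p. p \<in> frontier \<Omega> \<Longrightarrow> frechet_derivative \<rho> (at p) \<noteq> (\<lambda>_. 0)"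
    by blast
  have "continuous_on U \<rho>" using spec[OF U(4), of 0] by simp
  have "\<rho> p = 0" if p: "p \<in> frontier \<Omega>" for p
  proof (rule antisym)
    have pU: "p \<in> U" "p \<in> closure \<Omega>" "p \<notin> \<Omega>"
      using p U(1,3) by (auto simp: frontier_def interior_open)
    then show "0 \<le> \<rho> p" using U(5) by fastforce
    show "\<rho> p \<le> 0"
    proof (rule ccontr)
      assume "\<not> \<rho> p \<le> 0"
      then have "p \<in> U \<inter> \<rho> -` {0<..}" using pU(1) by simp
      moreover have "open (U \<inter> \<rho> -` {0<..})"
        using \<open>continuous_on U \<rho>\<close> U(2) by (intro continuous_open_preimage) auto
      ultimately have "(U \<inter> \<rho> -` {0<..}) \<inter> \<Omega> \<noteq> {}"
        using pU(2) open_Int_closure_eq_empty by blast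
      then obtain x where "x \<in> U" "x \<in> \<Omega>" "0 < \<rho> x" by auto
      moreover from this have "x \<in> {z\<in>U. \<rho> z < 0}" using U(5) by blast
      ultimately show False by simp
    qed
  qed
  then show ?thesis
    using U reg by (intro negligible_regular_zero_set[of U _ \<rho>]) auto
qed

section \<open>Combining the polynomial approximation with the superharmonic correction\<close>

theorem corollary1p4:
  fixes \<Omega> :: "(complex ^ 'n::finite) set"
    and g \<phi> :: "complex ^ 'n \<Rightarrow> real"
  assumes "smooth_bounded_strongly_pseudoconvex_domain \<Omega>"
    and "continuous_on \<Omega> g"
    and "bounded (g ` \<Omega>)"
    and "\<forall>z\<in>\<Omega>. g z \<ge> 0"
    and "negligible_in \<Omega> {z\<in>\<Omega>. g z = 0}"
    and "continuous_on (closure \<Omega>) \<phi>"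
    and "plurisubharmonic_on \<Omega> (\<lambda>z. ereal (\<phi> z))"
  shows "admissible \<Omega> \<phi> g"
  unfolding admissible_def
proof (intro allI impI)
  fix \<epsilon> :: real assume \<epsilon>: "\<epsilon> > 0"
  have \<Omega>: "open \<Omega>" "bounded \<Omega>"
    using assms(1) by (auto simp: smooth_bounded_strongly_pseudoconvex_domain_def)
  then have cpt: "compact (closure \<Omega>)" by simp
  define E where "E = frontier \<Omega> \<union> {z\<in>\<Omega>. g z = 0}"
  \<comment> \<open>The zero set alone is closed only relative to \<Omega>; together with the
    frontier it is a compact set minus an open one.\<close>
  have E_eq: "E = closure \<Omega> - (\<Omega> \<inter> g -` (- {0}))"
    using \<Omega>(1) closure_subset[of \<Omega>] by (auto simp: E_def frontier_def interior_open)
  have "open (\<Omega> \<inter> g -` (- {0}))"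
    using assms(2) \<Omega>(1) by (intro continuous_open_preimage) auto
  then have E_cpt: "compact E" unfolding E_eq by (intro compact_diff cpt)
  have E_null: "negligible E"
    unfolding E_def using negligible_frontier_smooth_domain[OF assms(1)]
      negligible_in_imp_negligible[OF \<Omega>(1) assms(5)] by (rule negligible_Un)
  obtain R where R: "closure \<Omega> \<subseteq> cball 0 R"
    using compact_imp_bounded[OF cpt] by (auto simp: bounded_iff subset_iff)
  have \<epsilon>4: "\<epsilon> / 4 > 0" using \<epsilon> by simp
  \<comment> \<open>The shift by \<epsilon> / 2 leaves room on both sides: f stays between \<phi> +
    \<epsilon> / 4 and \<phi> + 3 \<epsilon> / 4, and s adds at most \<epsilon> / 4.\<close>
  have cont: "continuous_on (closure \<Omega>) (\<lambda>z. \<phi> z + \<epsilon> / 2)" by (intro continuous_intros assms(6))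
  obtain f where f: "real_polynomial_function f" "\<And>z. z \<in> closure \<Omega> \<Longrightarrow> \<bar>(\<phi> z + \<epsilon> / 2) - f z\<bar> < \<epsilon> / 4"
    using Stone_Weierstrass_real_polynomial_function[OF cpt cont \<epsilon>4] by blast
  have "\<forall>b. \<exists>d. real_polynomial_function d \<and> (\<forall>z. has_second_difference f b z (d z))"
  proof
    fix b
    show "\<exists>d. real_polynomial_function d \<and> (\<forall>z. has_second_difference f b z (d z))"
      by (rule real_polynomial_function_second_difference[OF f(1), of b]) blast
  qed
  from choice[OF this] obtain d
    where d: "\<And>b. real_polynomial_function (d b)" "\<And>b z. has_second_difference f b z (d b z)"
    by blast
  have "continuous_on (closure \<Omega>) (\<lambda>z. \<Sum>b\<in>Basis. d b z)"
    by (intro continuous_intros continuous_on_polymonial_function) (use d(1) in \<open>simp add: real_polynomial_function_eq\<close>)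
  from compact_imp_bounded[OF compact_continuous_image[OF this cpt]]
  obtain L where L: "L > 0" "\<And>z. z \<in> closure \<Omega> \<Longrightarrow> \<bar>\<Sum>b\<in>Basis. d b z\<bar> \<le> L"
    by (auto simp: bounded_pos)
  have dim: "DIM(complex ^ 'n) \<ge> 2" by (simp add: Suc_leI)
  have ER: "E \<subseteq> cball 0 R" using R by (auto simp: E_eq)
  \<comment> \<open>The extra 1 makes the Laplacian of f + s strictly negative on W.\<close>
  have L1: "L + 1 > 0" using L(1) by simp
  obtain W s e where W: "open W" "E \<subseteq> W" and s: "continuous_on UNIV s"
    "\<And>z. norm z \<le> R \<Longrightarrow> 0 \<le> s z \<and> s z \<le> \<epsilon> / 4"
    and e: "\<And>b z. b \<in> Basis \<Longrightarrow> has_second_difference s b z (e b z)"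
    "\<And>z. (\<Sum>b\<in>Basis. e b z) \<le> 0" "\<And>z. z \<in> W \<Longrightarrow> (\<Sum>b\<in>Basis. e b z) \<le> - (L + 1)"
  proof (rule small_superharmonic_function[OF dim E_cpt E_null ER L1 \<epsilon>4], goal_cases)
    case (1 W s e)
    show thesis by (rule 1(1)[OF 1(2-)])
  qed
  define u where "u z = f z + s z" for z
  define N where "N = 2 ^ CARD('n) * fact CARD('n) * (fact CARD('n) * L ^ CARD('n))"
  have N: "N > 0" using L(1) by (simp add: N_def)
  obtain c where c: "c > 0" "\<And>z. z \<in> \<Omega> - W \<Longrightarrow> c \<le> g z"
  proof -
    \<comment> \<open>W contains the frontier, so removing it from \<Omega> leaves a compact
      set.\<close>
    have eq: "\<Omega> - W = closure \<Omega> - W"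
      using W(2) \<Omega>(1) closure_subset[of \<Omega>] by (auto simp: E_def frontier_def interior_open)
    have K: "compact (\<Omega> - W)" unfolding eq by (intro compact_diff cpt W)
    have pos: "g z > 0" if "z \<in> \<Omega> - W" for z
      using that W(2) assms(4) by (force simp: E_def order_less_le)
    show thesis
    proof (cases "\<Omega> - W = {}")
      case True
      then show thesis using that[of 1] by auto
    next
      case False
      have "continuous_on (\<Omega> - W) g" using assms(2) by (rule continuous_on_subset) auto
      from continuous_attains_inf[OF K False this] show thesis using that pos by metis
    qed
  qed
  show "\<exists>u C. continuous_on (closure \<Omega>) u \<and> C > 0 \<and>
        (\<forall>z\<in>closure \<Omega>. \<phi> z \<le> u z \<and> u z \<le> \<phi> z + \<epsilon>) \<and>
        viscosity_MA_le \<Omega> u (\<lambda>z. exp C * g z)"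
  proof (intro exI conjI ballI)
    show "continuous_on (closure \<Omega>) u"
      unfolding u_def [abs_def]
      by (intro continuous_intros continuous_on_polymonial_function continuous_on_subset[OF s(1)])
        (use f(1) in \<open>auto simp: real_polynomial_function_eq\<close>)
    \<comment> \<open>This fixes C as \<open>N / c\<close>: off W one has g >= c, and
      \<open>N / c \<le> exp (N / c)\<close> then gives \<open>N \<le> exp C * g\<close>.\<close>
    show "N / c > 0" using N c(1) by simp
    fix z assume z: "z \<in> closure \<Omega>"
    then have "norm z \<le> R" using R by auto
    from s(2)[OF this] f(2)[OF z] show "\<phi> z \<le> u z" "u z \<le> \<phi> z + \<epsilon>"
      by (auto simp: u_def abs_if split: if_splits)
  next
    show "viscosity_MA_le \<Omega> u (\<lambda>z. exp (N / c) * g z)"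
      unfolding viscosity_MA_le_def
    proof (intro ballI allI impI, elim conjE)
      fix z q U assume z: "z \<in> \<Omega>" and U: "open U" "z \<in> U" and q: "Ck_on 2 q U"
        and touch: "q z = u z" "\<forall>\<^sub>F x in nhds z. q x \<le> u x" and psh: "ddc_nonneg q z"
      define \<Delta> where "\<Delta> = (\<Sum>b\<in>Basis. mixed_derivative q b b z)"
      note \<Delta> = monge_ampere_density_le_laplacian[OF U q psh, folded \<Delta>_def]
      have "\<Delta> \<le> (\<Sum>b\<in>Basis. d b z + e b z)"
        unfolding \<Delta>_def
      proof (rule sum_mono)
        fix b :: "complex ^ 'n" assume b: "b \<in> Basis"
        show "mixed_derivative q b b z \<le> d b z + e b z"
          by (rule has_second_difference_touching[OF Ck_on_2_second_difference[OF U q] _ touch(2,1)])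
            (unfold u_def [abs_def], intro has_second_difference_add d e b)
      qed
      also have "\<dots> \<le> L + (\<Sum>b\<in>Basis. e b z)"
        using L(2)[of z] z closure_subset[of \<Omega>] by (auto simp: sum.distrib)
      finally have le: "\<Delta> \<le> L + (\<Sum>b\<in>Basis. e b z)" .
      \<comment> \<open>On W the bound would read \<Delta> <= - 1, against the nonnegative trace; no
        admissible test function touches u there.\<close>
      have "z \<notin> W" using le e(3)[of z] \<Delta>(1) by force
      with c(2) z have cg: "c \<le> g z" by simp
      have "monge_ampere_density q z \<le> N"
      proof -
        have "\<Delta> \<le> L" using le e(2)[of z] by simp
        then have "\<Delta> ^ CARD('n) \<le> L ^ CARD('n)" using \<Delta>(1) by (rule power_mono)
        then have "2 ^ CARD('n) * fact CARD('n) * (fact CARD('n) * \<Delta> ^ CARD('n)) \<le> N"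
          unfolding N_def by (intro mult_left_mono) auto
        with \<Delta>(2) show ?thesis by linarith
      qed
      also have "N = N / c * c" using c(1) by simp
      also have "\<dots> \<le> exp (N / c) * g z"
      proof (intro mult_mono cg)
        show "N / c \<le> exp (N / c)" using exp_ge_add_one_self[of "N / c"] by linarith
      qed (use c(1) in auto)
      finally show "monge_ampere_density q z \<le> exp (N / c) * g z" .
    qed
  qed
qed

end
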